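(* Let $L\ge1$ and consider the FNO $G_\theta(\boldsymbol{x},\boldsymbol{y})$ of depth $L$ defined in the context, where the field $a(\boldsymbol{x},\boldsymbol{y})$ is either affine or Chebyshev, with basis functions $\psi_j$ and index set $\mathcal{A}=\{\boldsymbol{h}\in\mathbb{Z}^d:r(\boldsymbol{h})\le M\}$ for some $M>0$ as specified there. Let, for some $\omega\ge1$, $$J:=2\eta\sum_{\boldsymbol{h}\in\mathcal{A}}\frac{\prod_{p\in\mathrm{supp}(\boldsymbol{h})}|h_p|^\omega}{r(\boldsymbol{h})}.$$ Suppose there exist positive sequences $(R_\ell)_{\ell\ge1}$ and $(A_n)_{n\ge1}$ such that $$\|W_\ell\|_\infty+\sum_{\boldsymbol{h}\in\mathcal{A}}\|\widehat{\kappa_\ell}(\boldsymbol{h})\|_\infty\le R_\ell\ (\ell=1,\dots,L),\qquad\|\sigma^{(n)}\|_\infty\le A_n\ (n\ge1),$$ and that $A_n=\xi\,\tau^n\,n!$ for all $n\ge1$, for some $\xi>0$, $\tau>0$. Define $\Pi_k:=\prod_{t=1}^k(\xi\,\tau\,R_t)$ and $$\widetilde C_L:=\max\Big\{\|G_\theta\|_\infty,\ \|Q\|_\infty\frac{\xi\,\Pi_L}{\sum_{k=1}^L\Pi_k}\Big\},\qquad\widetilde S_L:=1+\frac{\|P\|_\infty J}{\xi}\sum_{k=1}^L\Pi_k.$$ Then for every multiindex $\boldsymbol{\nu}\in\mathbb{N}_0^d$ with $0\le\|\boldsymbol{\nu}\|_\infty\le\omega$, $$\|\partial^{\boldsymbol{\nu}}_{\boldsymbol{x}}G_\theta\|_\infty\le\widetilde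 C_L\,(2\pi)^{|\boldsymbol{\nu}|}\,|\boldsymbol{\nu}|!\;\widetilde S_L^{|\boldsymbol{\nu}|}.$$
   Context: **Index set and fields.** $D=[0,1]^d$. Let $r:\mathbb{Z}^d\to(0,\infty)$ be a function (a "radius") such that $\mathbb{Z}^d$ can be enumerated as $\{\boldsymbol{h}_j:j\ge1\}$ with $1/r(\boldsymbol{h}_1)\ge1/r(\boldsymbol{h}_2)\ge\cdots$, and let $\mathcal{A}=\{\boldsymbol{h}\in\mathbb{Z}^d:r(\boldsymbol{h})\le M\}$, a finite set. The parametric dimension is $s=2|\mathcal{A}|$ and $Y=[0,1]^s$. The basis functions are $$\psi_0(\boldsymbol{x})=1,\quad\psi_{2j-1}(\boldsymbol{x})=\frac{\eta\,e^{2\pi\mathrm{i}\boldsymbol{h}_j\cdot\boldsymbol{x}}}{r(\boldsymbol{h}_j)},\quad\psi_{2j}(\boldsymbol{x})=\mathrm{i}\,\frac{\eta\,e^{2\pi\mathrm{i}\boldsymbol{h}_j\cdot\boldsymbol{x}}}{r(\boldsymbol{h}_j)}\quad(j\ge1),$$ where $\eta>0$ is a scaling factor chosen so that $\mathrm{Re}\,a(\boldsymbol{x},\boldsymbol{y})\ge a_{\min}>0$ for all $\boldsymbol{x}\in D$, $\boldsymbol{y}\in Y$. The affine field is $a(\boldsymbol{x},\boldsymbol{y})=\psi_0(\boldsymbol{x})+\sum_{j=1}^s(y_j-\tfrac12)\psi_j(\boldsymbol{x})$; the Chebyshev field is $a(\boldsymbol{x},\boldsymbol{y})=\psi_0(\boldsymbol{x})+\sum_{j=1}^s\sin(2\pi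 y_j)\psi_j(\boldsymbol{x})$. $\mathrm{supp}(\boldsymbol{h})=\{j:h_j\ne0\}$. **FNO.** Let $d_1,\dots,d_{L+1},d_u$ be positive integers. The parameters $\theta$ are $P\in\mathbb{R}^{d_1\times1}$, $Q\in\mathbb{R}^{d_u\times d_{L+1}}$ and, for $\ell=1,\dots,L$, $W_\ell\in\mathbb{R}^{d_{\ell+1}\times d_\ell}$, $b_\ell\in\mathbb{R}^{d_{\ell+1}}$, $\widehat{\kappa_\ell}(\boldsymbol{h})\in\mathbb{C}^{d_{\ell+1}\times d_\ell}$ ($\boldsymbol{h}\in\mathcal{A}$). The activation $\sigma:\mathbb{R}\to\mathbb{R}$ is infinitely differentiable, applied componentwise to vectors, and to complex numbers by $\sigma(z)=\sigma(\mathrm{Re}\,z)+\mathrm{i}\,\sigma(\mathrm{Im}\,z)$; $\sigma^{(n)}$ is the $n$th derivative of the real function. Put $$(K_\ell v)(\boldsymbol{x})=\sum_{\boldsymbol{h}\in\mathcal{A}}\widehat{\kappa_\ell}(\boldsymbol{h})\,\widehat v(\boldsymbol{h})\,e^{2\pi\mathrm{i}\boldsymbol{h}\cdot\boldsymbol{x}},\qquad\widehat v(\boldsymbol{h})=\int_Dv(\boldsymbol{x})e^{-2\pi\mathrm{i}\boldsymbol{h}\cdot\boldsymbol{x}}\,\mathrm{d}\boldsymbol{x}.$$ The FNO is $G_\theta(\boldsymbol{x},\boldsymbol{y}):=Q\,\sigma(g^{[L]}(\boldsymbol{x},\boldsymbol{y}))$, where $g^{[1]}(\boldsymbol{x},\boldsymbol{y}):=W_1P\,a(\boldsymbol{x},\boldsymbol{y})+(K_1P\,a(\cdot,\boldsymbol{y}))(\boldsymbol{x})+b_1$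 and $g^{[\ell]}(\boldsymbol{x},\boldsymbol{y}):=W_\ell\,\sigma(g^{[\ell-1]}(\boldsymbol{x},\boldsymbol{y}))+(K_\ell\,\sigma(g^{[\ell-1]}(\cdot,\boldsymbol{y})))(\boldsymbol{x})+b_\ell$ for $2\le\ell\le L$. **Norms.** $\|\cdot\|_\infty$ is the matrix $\infty$-norm (maximum absolute row sum) for matrices, the sup-norm for scalar functions, the max-norm for multiindices, and for $G_\theta$ and its derivatives the vector $\infty$-norm followed by the sup over $D\times Y$. $|\boldsymbol{\nu}|=\sum_j\nu_j$, $\partial^{\boldsymbol{\nu}}_{\boldsymbol{x}}=\prod_{j=1}^d(\partial/\partial x_j)^{\nu_j}$. *)

theory Defs
  imports "HOL-Analysis.Analysis"
begin

(* Vectors and matrices whose sizes vary with the layer are functions on indices starting at 1: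
   an m x n matrix is read only at (i, j) in {1..m} x {1..n}, and the sizes are passed explicitly.
   Points of R^d, frequencies in Z^d and multiindices in N^d use the finite index type 'd. *)

definition vec_inf_norm :: "nat \<Rightarrow> (nat \<Rightarrow> 'a::real_normed_vector) \<Rightarrow> real" where
  "vec_inf_norm m v = (MAX i\<in>{1..m}. norm (v i))"

definition mat_inf_norm :: "nat \<Rightarrow> nat \<Rightarrow> (nat \<Rightarrow> nat \<Rightarrow> 'a::real_normed_vector) \<Rightarrow> real" where
  "mat_inf_norm m n A = (MAX i\<in>{1..m}. \<Sum>j=1..n. norm (A i j))"

(* Extended-real valued, so that an upper bound on it does assert boundedness. *)
definition sup_norm :: "'a set \<Rightarrow> ('a \<Rightarrow> 'b::real_normed_vector) \<Rightarrow> ereal" where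
  "sup_norm S f = (SUP x\<in>S. ereal (norm (f x)))"

definition freq_dot :: "int ^ 'd \<Rightarrow> real ^ 'd \<Rightarrow> real" where
  "freq_dot h x = (\<Sum>p\<in>UNIV. real_of_int (h $ p) * x $ p)"

definition supp :: "int ^ 'd \<Rightarrow> 'd set" where
  "supp h = {p. h $ p \<noteq> 0}"

definition spatial_domain :: "(real ^ 'd) set" where
  "spatial_domain = cbox 0 1"

definition param_domain :: "nat \<Rightarrow> (nat \<Rightarrow> real) set" where
  "param_domain s = (\<Pi>\<^sub>E j\<in>{1..s}. {0..1})"

definition index_set :: "(int ^ 'd \<Rightarrow> real) \<Rightarrow> real \<Rightarrow> (int ^ 'd) set" where
  "index_set r M = {h. r h \<le> M}"

(* hs enumerates the frequencies from index 1 on; for j >= 1 the functions at indices 2 j - 1 and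
   2 j both belong to hs j, and (k + 1) div 2 = j holds for k = 2 j - 1 and for k = 2 j. *)
definition psi ::
  "real \<Rightarrow> (int ^ 'd \<Rightarrow> real) \<Rightarrow> (nat \<Rightarrow> int ^ 'd) \<Rightarrow> nat \<Rightarrow> real ^ 'd \<Rightarrow> complex" where
  "psi \<eta> r hs k x =
     (if k = 0 then 1
      else (let h = hs ((k + 1) div 2);
                w = of_real \<eta> * exp (2 * of_real pi * \<i> * of_real (freq_dot h x)) / of_real (r h)
            in if odd k then w else \<i> * w))"

definition affine_field ::
  "real \<Rightarrow> (int ^ 'd \<Rightarrow> real) \<Rightarrow> (nat \<Rightarrow> int ^ 'd) \<Rightarrow> nat \<Rightarrow> real ^ 'd \<Rightarrow> (nat \<Rightarrow> real) \<Rightarrow> complex" where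
  "affine_field \<eta> r hs s x y =
     psi \<eta> r hs 0 x + (\<Sum>j=1..s. of_real (y j - 1/2) * psi \<eta> r hs j x)"

definition chebyshev_field ::
  "real \<Rightarrow> (int ^ 'd \<Rightarrow> real) \<Rightarrow> (nat \<Rightarrow> int ^ 'd) \<Rightarrow> nat \<Rightarrow> real ^ 'd \<Rightarrow> (nat \<Rightarrow> real) \<Rightarrow> complex" where
  "chebyshev_field \<eta> r hs s x y =
     psi \<eta> r hs 0 x + (\<Sum>j=1..s. of_real (sin (2 * pi * y j)) * psi \<eta> r hs j x)"

definition complex_activation :: "(real \<Rightarrow> real) \<Rightarrow> complex \<Rightarrow> complex" where
  "complex_activation \<sigma> z = Complex (\<sigma> (Re z)) (\<sigma> (Im z))"

definition fourier_coeff :: "(real ^ 'd \<Rightarrow> complex) \<Rightarrow> int ^ 'd \<Rightarrow> complex" where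
  "fourier_coeff v h =
     integral spatial_domain (\<lambda>x. v x * exp (- (2 * of_real pi * \<i> * of_real (freq_dot h x))))"

(* The argument n is the number of columns of the matrices K h. *)
definition kernel_op ::
  "(int ^ 'd) set \<Rightarrow> nat \<Rightarrow> (int ^ 'd \<Rightarrow> nat \<Rightarrow> nat \<Rightarrow> complex) \<Rightarrow>
   (real ^ 'd \<Rightarrow> nat \<Rightarrow> complex) \<Rightarrow> real ^ 'd \<Rightarrow> nat \<Rightarrow> complex" where
  "kernel_op \<A> n K v x i =
     (\<Sum>h\<in>\<A>. (\<Sum>j=1..n. K h i j * fourier_coeff (\<lambda>z. v z j) h)
               * exp (2 * of_real pi * \<i> * of_real (freq_dot h x)))"

definition fno_layer ::
  "(int ^ 'd) set \<Rightarrow> nat \<Rightarrow> (nat \<Rightarrow> nat \<Rightarrow> real) \<Rightarrow> (int ^ 'd \<Rightarrow> nat \<Rightarrow> nat \<Rightarrow> complex) \<Rightarrow>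
   (nat \<Rightarrow> real) \<Rightarrow> (real ^ 'd \<Rightarrow> nat \<Rightarrow> complex) \<Rightarrow> real ^ 'd \<Rightarrow> nat \<Rightarrow> complex" where
  "fno_layer \<A> n W K b v x i =
     (\<Sum>j=1..n. of_real (W i j) * v x j) + kernel_op \<A> n K v x i + of_real (b i)"

(* fno_pre ... u l is the pre-activation g^[l] for the input field u; the layers are numbered from 1,
   and the value at 0 is a placeholder that is never used. *)
primrec fno_pre ::
  "(int ^ 'd) set \<Rightarrow> (nat \<Rightarrow> nat) \<Rightarrow> (real \<Rightarrow> real) \<Rightarrow> (nat \<Rightarrow> nat \<Rightarrow> real) \<Rightarrow>
   (nat \<Rightarrow> nat \<Rightarrow> nat \<Rightarrow> real) \<Rightarrow> (nat \<Rightarrow> int ^ 'd \<Rightarrow> nat \<Rightarrow> nat \<Rightarrow> complex) \<Rightarrow> (nat \<Rightarrow> nat \<Rightarrow> real) \<Rightarrow>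
   (real ^ 'd \<Rightarrow> complex) \<Rightarrow> nat \<Rightarrow> real ^ 'd \<Rightarrow> nat \<Rightarrow> complex" where
  "fno_pre \<A> dims \<sigma> P W K b u 0 = (\<lambda>x i. 0)"
| "fno_pre \<A> dims \<sigma> P W K b u (Suc l) =
     fno_layer \<A> (dims (Suc l)) (W (Suc l)) (K (Suc l)) (b (Suc l))
       (if l = 0 then (\<lambda>x i. of_real (P i 1) * u x)
        else (\<lambda>x i. complex_activation \<sigma> (fno_pre \<A> dims \<sigma> P W K b u l x i)))"

definition fno ::
  "(int ^ 'd) set \<Rightarrow> nat \<Rightarrow> (nat \<Rightarrow> nat) \<Rightarrow> (real \<Rightarrow> real) \<Rightarrow> (nat \<Rightarrow> nat \<Rightarrow> real) \<Rightarrow>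
   (nat \<Rightarrow> nat \<Rightarrow> real) \<Rightarrow>
   (nat \<Rightarrow> nat \<Rightarrow> nat \<Rightarrow> real) \<Rightarrow> (nat \<Rightarrow> int ^ 'd \<Rightarrow> nat \<Rightarrow> nat \<Rightarrow> complex) \<Rightarrow> (nat \<Rightarrow> nat \<Rightarrow> real) \<Rightarrow>
   (real ^ 'd \<Rightarrow> (nat \<Rightarrow> real) \<Rightarrow> complex) \<Rightarrow> real ^ 'd \<Rightarrow> (nat \<Rightarrow> real) \<Rightarrow> nat \<Rightarrow> complex" where
  "fno \<A> L dims \<sigma> P Q W K b a x y k =
     (\<Sum>i=1..dims (L + 1). of_real (Q k i) *
        complex_activation \<sigma> (fno_pre \<A> dims \<sigma> P W K b (\<lambda>z. a z y) L x i))"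

(* Partial derivatives of functions on R^d. The formulas for the fields and the network make sense on
   all of R^d (as 1-periodic functions), so no one-sided derivatives are needed at the faces of the
   cube. *)
definition partial_deriv :: "'d \<Rightarrow> (real ^ 'd \<Rightarrow> complex) \<Rightarrow> real ^ 'd \<Rightarrow> complex" where
  "partial_deriv p f x = vector_derivative (\<lambda>t. f (x + t *\<^sub>R axis p 1)) (at 0)"

definition partially_differentiable :: "'d \<Rightarrow> (real ^ 'd \<Rightarrow> complex) \<Rightarrow> bool" where
  "partially_differentiable p f \<longleftrightarrow> (\<forall>x. (\<lambda>t. f (x + t *\<^sub>R axis p 1)) differentiable (at 0))"

primrec iter_partial :: "'d list \<Rightarrow> (real ^ 'd \<Rightarrow> complex) \<Rightarrow> real ^ 'd \<Rightarrow> complex" where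
  "iter_partial [] f = f"
| "iter_partial (p # ps) f = partial_deriv p (iter_partial ps f)"

primrec iter_partially_differentiable :: "'d list \<Rightarrow> (real ^ 'd \<Rightarrow> complex) \<Rightarrow> bool" where
  "iter_partially_differentiable [] f \<longleftrightarrow> True"
| "iter_partially_differentiable (p # ps) f \<longleftrightarrow>
     iter_partially_differentiable ps f \<and> partially_differentiable p (iter_partial ps f)"

(* The list axs numbers the coordinate axes 1, ..., d. The operator for the multiindex nu is
   the product over j = 1, ..., d of the nu_j-th powers of the j-th partial derivative, the factors
   being composed in this order. *)
definition multi_axes :: "'d list \<Rightarrow> nat ^ 'd \<Rightarrow> 'd list" where
  "multi_axes axs \<nu> = concat (map (\<lambda>p. replicate (\<nu> $ p) p) axs)"

definition mixed_partial ::
  "'d list \<Rightarrow> nat ^ 'd \<Rightarrow> (real ^ 'd \<Rightarrow> complex) \<Rightarrow> real ^ 'd \<Rightarrow> complex" where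
  "mixed_partial axs \<nu> = iter_partial (multi_axes axs \<nu>)"

definition has_mixed_partial :: "'d list \<Rightarrow> nat ^ 'd \<Rightarrow> (real ^ 'd \<Rightarrow> complex) \<Rightarrow> bool" where
  "has_mixed_partial axs \<nu> = iter_partially_differentiable (multi_axes axs \<nu>)"

definition multi_abs :: "nat ^ 'd \<Rightarrow> nat" where
  "multi_abs \<nu> = (\<Sum>p\<in>UNIV. \<nu> $ p)"

definition multi_max :: "nat ^ 'd \<Rightarrow> nat" where
  "multi_max \<nu> = (MAX p. \<nu> $ p)"

end

theory Submission imports Defs "HOL-Library.Sublist" begin

text \<open>Derivatives are tracked through words of differentiation axes and majorised by exponential
  generating functions in one variable. A function whose \<open>n\<close>-th order derivatives (\<open>n \<ge> 1\<close>) are at most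
  \<open>n! \<alpha> \<beta>^(n-1)\<close> has the majorant \<open>\<alpha> t / (1 - \<beta> t)\<close>, and the hypothesis on \<open>\<sigma>\<close> gives it the majorant
  \<open>\<xi> \<tau> u / (1 - \<tau> u)\<close>. Composition of these Moebius maps sends \<open>(\<alpha>, \<beta>)\<close> to \<open>(\<xi> \<tau> \<alpha>, \<beta> + \<tau> \<alpha>)\<close>.
  An affine layer multiplies \<open>\<alpha>\<close> by at most \<open>R l\<close>: the spectral convolution commutes with derivatives,
  because the field is periodic, and Fourier coefficients are bounded by the sup-norm. Starting from
  \<open>\<alpha> = 2 pi \<parallel>P\<parallel> J\<close> and \<open>\<beta> = 2 pi\<close> for the input field, the recursion after \<open>L\<close> layers ends at
  \<open>\<alpha> = 2 pi \<parallel>P\<parallel> J \<Lambda> L\<close> and \<open>\<beta> = 2 pi S\<close>.\<close>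

subsection \<open>Partial derivatives and smooth functions\<close>

text \<open>\<open>partial_deriv\<close> is total and has a value even where no derivative exists.
  The relational form asserts existence together with the value, so calculus rules can be chained
  and turned into equations by \<open>partial_deriv_eqI\<close>.\<close>

definition has_partial :: "'d::finite \<Rightarrow> (real ^ 'd \<Rightarrow> complex) \<Rightarrow> (real ^ 'd \<Rightarrow> complex) \<Rightarrow> bool" where
  "has_partial p f f' \<longleftrightarrow>
     (\<forall>x. ((\<lambda>t. f (x + t *\<^sub>R axis p 1)) has_vector_derivative f' x) (at 0))"

lemma has_partialD: "has_partial p f f' \<Longrightarrow>
    ((\<lambda>t. f (x + t *\<^sub>R axis p 1)) has_vector_derivative f' x) (at 0)"
  by (simp add: has_partial_def)

lemma partial_deriv_eqI: "has_partial p f f' \<Longrightarrow> partial_deriv p f = f'"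
  by (auto simp: has_partial_def partial_deriv_def fun_eq_iff intro!: vector_derivative_at)

lemma partially_differentiable_iff:
  "partially_differentiable p f \<longleftrightarrow> has_partial p f (partial_deriv p f)"
  by (simp add: partially_differentiable_def has_partial_def partial_deriv_def
      vector_derivative_works)

lemma has_partial_imp_partially_differentiable:
  "has_partial p f f' \<Longrightarrow> partially_differentiable p f"
  using partial_deriv_eqI partially_differentiable_iff by metis

text \<open>Derivatives are defined at parameter 0 only; moving the base point to
  \<open>x + t *\<^sub>R axis p 1\<close> gives every other \<open>t\<close>, as differentiation
  under the integral sign requires.\<close>

lemma has_partial_along_line:
  assumes "has_partial p f f'"
  shows "((\<lambda>t. f (x + t *\<^sub>R axis p 1)) has_vector_derivative f' (x + t *\<^sub>R axis p 1)) (at t within A)"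
proof -
  have "((\<lambda>s. f ((x + t *\<^sub>R axis p 1) + s *\<^sub>R axis p 1))
          has_vector_derivative f' (x + t *\<^sub>R axis p 1)) (at (t - t))"
    using has_partialD[OF assms] by simp
  moreover have "((\<lambda>s. s - t) has_vector_derivative 1) (at t)"
    by (auto intro!: derivative_eq_intros)
  ultimately have "(((\<lambda>s. f ((x + t *\<^sub>R axis p 1) + s *\<^sub>R axis p 1)) \<circ> (\<lambda>s. s - t))
          has_vector_derivative 1 *\<^sub>R f' (x + t *\<^sub>R axis p 1)) (at t)"
    by (rule vector_diff_chain_at[rotated])
  then show ?thesis
    by (simp add: o_def has_vector_derivative_at_within algebra_simps)
qed

lemma has_partial_const: "has_partial p (\<lambda>x. c) (\<lambda>x. 0)"
  by (simp add: has_partial_def)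

lemma has_partial_add:
  "has_partial p f f' \<Longrightarrow> has_partial p g g' \<Longrightarrow> has_partial p (\<lambda>x. f x + g x) (\<lambda>x. f' x + g' x)"
  by (auto simp: has_partial_def intro: has_vector_derivative_add)

lemma has_partial_cmult: "has_partial p f f' \<Longrightarrow> has_partial p (\<lambda>x. c * f x) (\<lambda>x. c * f' x)"
  by (auto simp: has_partial_def intro: has_vector_derivative_mult_right)

lemma has_partial_sum:
  "(\<And>i. i \<in> I \<Longrightarrow> has_partial p (f i) (f' i)) \<Longrightarrow>
   has_partial p (\<lambda>x. \<Sum>i\<in>I. f i x) (\<lambda>x. \<Sum>i\<in>I. f' i x)"
  by (auto simp: has_partial_def intro: has_vector_derivative_sum)

lemma has_partial_mult:
  "has_partial p f f' \<Longrightarrow> has_partial p g g' \<Longrightarrow>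
   has_partial p (\<lambda>x. f x * g x) (\<lambda>x. f x * g' x + f' x * g x)"
  unfolding has_partial_def using has_vector_derivative_mult by fastforce

text \<open>The class C^n on the whole space. Recursion through first-order partial derivatives lets
  sum, product and chain rules follow by induction on \<open>n\<close>.\<close>

primrec cn :: "nat \<Rightarrow> (real ^ 'd::finite \<Rightarrow> complex) \<Rightarrow> bool" where
  "cn 0 f \<longleftrightarrow> continuous_on UNIV f"
| "cn (Suc n) f \<longleftrightarrow>
     continuous_on UNIV f \<and> (\<forall>p. partially_differentiable p f \<and> cn n (partial_deriv p f))"

lemma cn_imp_continuous: "cn n f \<Longrightarrow> continuous_on UNIV f"
  by (cases n) auto

lemma cn_SucI:
  assumes "continuous_on UNIV f" "\<And>p. has_partial p f (f' p)" "\<And>p. cn n (f' p)"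
  shows "cn (Suc n) f"
  unfolding cn.simps
  using assms(1,3) has_partial_imp_partially_differentiable[OF assms(2)] partial_deriv_eqI[OF assms(2)]
  by simp

lemma cn_SucD: "cn (Suc n) f \<Longrightarrow> has_partial p f (partial_deriv p f)"
  "cn (Suc n) f \<Longrightarrow> cn n (partial_deriv p f)"
  by (auto simp: partially_differentiable_iff)

lemma cn_SucD_weak: "cn (Suc n) f \<Longrightarrow> cn n f"
  by (induction n arbitrary: f) auto

definition smooth :: "(real ^ 'd::finite \<Rightarrow> complex) \<Rightarrow> bool" where
  "smooth f \<longleftrightarrow> (\<forall>n. cn n f)"

lemma smooth_has_partial: "smooth f \<Longrightarrow> has_partial p f (partial_deriv p f)"
  unfolding smooth_def using cn_SucD(1) by blast

lemma smooth_partial_deriv: "smooth f \<Longrightarrow> smooth (partial_deriv p f)"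
  unfolding smooth_def using cn_SucD(2) by blast

lemma smooth_continuous: "smooth f \<Longrightarrow> continuous_on S f"
  unfolding smooth_def by (metis cn.simps(1) continuous_on_subset subset_UNIV)

lemma smooth_iter_partial: "smooth f \<Longrightarrow> smooth (iter_partial ps f)"
  by (induction ps) (auto intro: smooth_partial_deriv)

lemma smooth_iter_partially_differentiable: "smooth f \<Longrightarrow> iter_partially_differentiable ps f"
  by (induction ps)
    (auto simp: partially_differentiable_iff intro: smooth_has_partial smooth_iter_partial)

lemma iter_partial_append: "iter_partial (ps @ qs) f = iter_partial ps (iter_partial qs f)"
  by (induction ps) auto

lemma cn_add: "cn n f \<Longrightarrow> cn n g \<Longrightarrow> cn n (\<lambda>x. f x + g x)"
proof (induction n arbitrary: f g)
  case 0
  then show ?case by (auto intro: continuous_intros)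
next
  case (Suc n)
  show ?case
    by (rule cn_SucI[OF _ has_partial_add[OF cn_SucD(1) cn_SucD(1)]])
      (use Suc in \<open>auto intro: continuous_intros\<close>)
qed

lemma cn_const: "cn n (\<lambda>x. c)"
proof (induction n arbitrary: c)
  case (Suc n)
  show ?case
    by (rule cn_SucI[OF _ has_partial_const]) (use Suc in auto)
qed auto

lemma cn_cmult: "cn n f \<Longrightarrow> cn n (\<lambda>x. c * f x)"
proof (induction n arbitrary: f)
  case 0
  then show ?case by (auto intro: continuous_intros)
next
  case (Suc n)
  show ?case
    by (rule cn_SucI[OF _ has_partial_cmult[OF cn_SucD(1)]])
      (use Suc in \<open>auto intro: continuous_intros\<close>)
qed

lemma smooth_const: "smooth (\<lambda>x. c)"
  by (simp add: smooth_def cn_const)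

lemma smooth_add: "smooth f \<Longrightarrow> smooth g \<Longrightarrow> smooth (\<lambda>x. f x + g x)"
  by (simp add: smooth_def cn_add)

lemma smooth_cmult: "smooth f \<Longrightarrow> smooth (\<lambda>x. c * f x)"
  by (simp add: smooth_def cn_cmult)

lemma smooth_sum: "(\<And>i. i \<in> I \<Longrightarrow> smooth (f i)) \<Longrightarrow> smooth (\<lambda>x. \<Sum>i\<in>I. f i x)"
  by (induction I rule: infinite_finite_induct) (auto intro: smooth_add smooth_const)

lemma partial_deriv_add:
  "smooth f \<Longrightarrow> smooth g \<Longrightarrow>
   partial_deriv p (\<lambda>x. f x + g x) = (\<lambda>x. partial_deriv p f x + partial_deriv p g x)"
  by (intro partial_deriv_eqI has_partial_add smooth_has_partial)

lemma iter_partial_add: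
  "smooth f \<Longrightarrow> smooth g \<Longrightarrow>
   iter_partial ps (\<lambda>x. f x + g x) = (\<lambda>x. iter_partial ps f x + iter_partial ps g x)"
  by (induction ps) (auto simp: partial_deriv_add smooth_iter_partial)

lemma iter_partial_cmult:
  "smooth f \<Longrightarrow> iter_partial ps (\<lambda>x. c * f x) = (\<lambda>x. c * iter_partial ps f x)"
  by (induction ps)
    (auto intro!: partial_deriv_eqI has_partial_cmult smooth_has_partial smooth_iter_partial)

lemma iter_partial_sum:
  "(\<And>i. i \<in> I \<Longrightarrow> smooth (f i)) \<Longrightarrow>
   iter_partial ps (\<lambda>x. \<Sum>i\<in>I. f i x) = (\<lambda>x. \<Sum>i\<in>I. iter_partial ps (f i) x)"
  by (induction ps)
    (auto intro!: partial_deriv_eqI has_partial_sum smooth_has_partial smooth_iter_partial)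

lemma iter_partial_const: "ps \<noteq> [] \<Longrightarrow> iter_partial ps (\<lambda>x. c) = (\<lambda>x. 0)"
proof (induction ps)
  case (Cons p ps)
  then show ?case
    by (cases "ps = []") (simp_all add: partial_deriv_eqI[OF has_partial_const])
qed simp

subsection \<open>The componentwise product and activations\<close>

text \<open>The activation acts separately on real and imaginary parts, so its chain rule produces
  this product of R^2 instead of complex multiplication.\<close>

definition cprod :: "complex \<Rightarrow> complex \<Rightarrow> complex" where
  "cprod z w = Complex (Re z * Re w) (Im z * Im w)"

definition cmax :: "complex \<Rightarrow> real" where
  "cmax z = max \<bar>Re z\<bar> \<bar>Im z\<bar>"

lemma cmax_nonneg: "0 \<le> cmax z" and cmax_le_norm: "cmax z \<le> norm z"
  by (auto simp: cmax_def abs_Re_le_cmod abs_Im_le_cmod)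

text \<open>Measuring one factor in the maximum norm avoids a factor \<open>sqrt 2\<close> per layer.\<close>

lemma norm_cprod_le: "norm (cprod z w) \<le> cmax z * norm w"
proof -
  have "(Re z * Re w)\<^sup>2 + (Im z * Im w)\<^sup>2 \<le> (cmax z)\<^sup>2 * (Re w)\<^sup>2 + (cmax z)\<^sup>2 * (Im w)\<^sup>2"
    unfolding power_mult_distrib
    by (intro add_mono mult_right_mono) (auto simp: cmax_def abs_le_square_iff[symmetric])
  also have "\<dots> = (cmax z * norm w)\<^sup>2"
    by (simp add: cmod_power2 power_mult_distrib algebra_simps)
  finally show ?thesis
    using cmax_nonneg[of z] by (simp add: cprod_def cmod_def real_le_lsqrt)
qed

lemma bounded_bilinear_cprod: "bounded_bilinear cprod"
proof
  show "\<exists>K. \<forall>a b. norm (cprod a b) \<le> norm a * norm b * K"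
    by (rule exI[of _ 1]) (metis cmax_le_norm norm_cprod_le mult.right_neutral mult_right_mono norm_ge_zero order_trans)
qed (auto simp: cprod_def complex_eq_iff algebra_simps)

lemma has_partial_cprod:
  "has_partial p f f' \<Longrightarrow> has_partial p g g' \<Longrightarrow>
   has_partial p (\<lambda>x. cprod (f x) (g x)) (\<lambda>x. cprod (f x) (g' x) + cprod (f' x) (g x))"
  unfolding has_partial_def
  using bounded_bilinear.has_vector_derivative[OF bounded_bilinear_cprod] by fastforce

lemma cn_cprod: "cn n f \<Longrightarrow> cn n g \<Longrightarrow> cn n (\<lambda>x. cprod (f x) (g x))"
proof (induction n arbitrary: f g)
  case 0
  then show ?case by (auto intro: bounded_bilinear.continuous_on[OF bounded_bilinear_cprod])
next
  case (Suc n)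
  have "cn n (\<lambda>x. cprod (f x) (partial_deriv p g x) + cprod (partial_deriv p f x) (g x))" for p
    using Suc.prems[THEN cn_SucD_weak] Suc.prems[THEN cn_SucD(2)] by (intro cn_add Suc.IH)
  moreover have "continuous_on UNIV (\<lambda>x. cprod (f x) (g x))"
    using Suc.prems[THEN cn_imp_continuous]
    by (intro bounded_bilinear.continuous_on[OF bounded_bilinear_cprod])
  ultimately show ?case
    by (intro cn_SucI[OF _ has_partial_cprod[OF Suc.prems[THEN cn_SucD(1)]]])
qed

lemma smooth_cprod: "smooth f \<Longrightarrow> smooth g \<Longrightarrow> smooth (\<lambda>x. cprod (f x) (g x))"
  by (simp add: smooth_def cn_cprod)

lemma has_vector_derivative_Complex:
  "(u has_real_derivative u') F \<Longrightarrow> (v has_real_derivative v') F \<Longrightarrow>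
   ((\<lambda>t. Complex (u t) (v t)) has_vector_derivative Complex u' v') F"
  unfolding Complex_eq
  by (intro has_vector_derivative_add has_vector_derivative_mult_right has_vector_derivative_of_real)

lemma has_partial_complex_activation:
  assumes \<sigma>: "\<And>t. \<sigma> field_differentiable (at t)" and g: "has_partial p g g'"
  shows "has_partial p (\<lambda>x. complex_activation \<sigma> (g x))
           (\<lambda>x. cprod (complex_activation (deriv \<sigma>) (g x)) (g' x))"
  unfolding has_partial_def
proof
  fix x
  let ?g = "\<lambda>t. g (x + t *\<^sub>R axis p 1)"
  \<comment> \<open>Real chain rule for one component; \<open>h\<close> is later \<open>Re\<close>
    and \<open>Im\<close>.\<close>
  have *: "((\<lambda>t. \<sigma> (h (?g t))) has_real_derivative (deriv \<sigma> (h (g x)) * h (g' x))) (at 0)"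
    if h: "bounded_linear h" for h :: "complex \<Rightarrow> real"
  proof -
    have "((\<lambda>t. h (?g t)) has_vector_derivative h (g' x)) (at 0)"
      using bounded_linear.has_vector_derivative[OF h has_partialD[OF g]] by simp
    then have "((\<lambda>t. h (?g t)) has_real_derivative h (g' x)) (at 0)"
      by (simp add: has_real_derivative_iff_has_vector_derivative)
    moreover have "(\<sigma> has_real_derivative deriv \<sigma> (h (g x))) (at (h (?g 0)))"
      using \<sigma>[of "h (g x)"] by (simp add: DERIV_deriv_iff_field_differentiable)
    ultimately have "((\<lambda>t. \<sigma> (h (?g t))) has_real_derivative (deriv \<sigma> (h (g x)) * h (g' x))) (at 0)"
      by (rule DERIV_chain2[rotated])
    then show ?thesis .
  qed
  show "((\<lambda>t. complex_activation \<sigma> (?g t)) has_vector_derivative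
          cprod (complex_activation (deriv \<sigma>) (g x)) (g' x)) (at 0)"
    unfolding complex_activation_def cprod_def
    using has_vector_derivative_Complex[OF *[OF bounded_linear_Re] *[OF bounded_linear_Im]] by simp
qed

lemma continuous_complex_activation:
  assumes "\<And>t. \<sigma> field_differentiable (at t)" "continuous_on UNIV g"
  shows "continuous_on UNIV (\<lambda>x. complex_activation \<sigma> (g x))"
proof -
  have \<sigma>: "isCont \<sigma> t" for t
    by (rule field_differentiable_imp_continuous_at[OF assms(1)])
  have "continuous_on UNIV \<sigma>"
    using \<sigma> continuous_at_imp_continuous_on by blast
  then have *: "continuous_on UNIV (\<lambda>x. \<sigma> (h (g x)))" if "continuous_on UNIV h" for h :: "complex \<Rightarrow> real"
    using that
    by (intro continuous_on_compose2[of UNIV \<sigma> UNIV "\<lambda>x. h (g x)"] continuous_on_compose2[of UNIV h UNIV g]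
        assms(2)) auto
  then show ?thesis
    unfolding complex_activation_def Complex_eq
    by (intro continuous_intros * continuous_on_id)
qed

text \<open>Each differentiation raises the order of the derivative of \<sigma> by one, so the
  induction on \<open>n\<close> has to cover all \<open>k\<close> at once.\<close>

lemma cn_complex_activation:
  assumes "\<And>k t. (deriv ^^ k) \<sigma> field_differentiable (at t)" "smooth g"
  shows "cn n (\<lambda>x. complex_activation ((deriv ^^ k) \<sigma>) (g x))"
proof (induction n arbitrary: k)
  case 0
  then show ?case
    using assms by (auto intro: continuous_complex_activation smooth_continuous)
next
  case (Suc n)
  have *: "deriv ((deriv ^^ k) \<sigma>) = (deriv ^^ (Suc k)) \<sigma>" for k by simp
  have "has_partial p (\<lambda>x. complex_activation ((deriv ^^ k) \<sigma>) (g x))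
      (\<lambda>x. cprod (complex_activation ((deriv ^^ Suc k) \<sigma>) (g x)) (partial_deriv p g x))" for p
    using has_partial_complex_activation[OF assms(1) smooth_has_partial[OF assms(2)]]
    unfolding * .
  moreover have "cn n (\<lambda>x. cprod (complex_activation ((deriv ^^ Suc k) \<sigma>) (g x)) (partial_deriv p g x))"
    for p
    using smooth_partial_deriv[OF assms(2), of p] by (intro cn_cprod Suc.IH) (simp add: smooth_def)
  moreover have "continuous_on UNIV (\<lambda>x. complex_activation ((deriv ^^ k) \<sigma>) (g x))"
    using assms by (intro continuous_complex_activation smooth_continuous)
  ultimately show ?case
    by (intro cn_SucI)
qed

lemma smooth_complex_activation:
  assumes "\<And>k t. (deriv ^^ k) \<sigma> field_differentiable (at t)" "smooth g"
  shows "smooth (\<lambda>x. complex_activation ((deriv ^^ k) \<sigma>) (g x))"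
  unfolding smooth_def using cn_complex_activation[OF assms] by blast

subsection \<open>Majorants\<close>

text \<open>Leibniz rule in terms of exponential generating functions: the product of the majorants
  majorises the product. The induction removes the last letter of the word, which is the derivative
  applied first; this replaces one of \<open>f\<close>, \<open>g\<close> by its derivative and the
  matching series by its \<open>fps_deriv\<close>. Bounds on all subwords are assumed because the
  Leibniz rule distributes the letters over both factors.\<close>

lemma norm_iter_partial_cprod_le:
  assumes "smooth f" "smooth g"
    and "\<And>qs. subseq qs ps \<Longrightarrow> cmax (iter_partial qs f x) \<le> fact (length qs) * fps_nth F (length qs)"
    and "\<And>qs. subseq qs ps \<Longrightarrow> norm (iter_partial qs g x) \<le> fact (length qs) * fps_nth H (length qs)"
  shows "norm (iter_partial ps (\<lambda>z. cprod (f z) (g z)) x) \<le> fact (length ps) * fps_nth (F * H) (length ps)"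
  using assms
proof (induction ps arbitrary: f g F H rule: rev_induct)
  case Nil
  have "norm (cprod (f x) (g x)) \<le> cmax (f x) * norm (g x)"
    by (rule norm_cprod_le)
  also have "\<dots> \<le> fps_nth F 0 * fps_nth H 0"
    using Nil(3)[of "[]"] Nil(4)[of "[]"] cmax_nonneg[of "f x"]
    by (intro mult_mono) (auto intro: order_trans)
  finally show ?case by simp
next
  case (snoc p ps)
  let ?n = "length ps"
  \<comment> \<open>Differentiating a function shifts its majorant: \<open>n! * (n + 1)\<close>
    equals \<open>(n + 1)!\<close>. The measure \<open>N\<close> is \<open>cmax\<close> for the
    first factor and \<open>norm\<close> for the second.\<close>
  have deriv_bound: "N (iter_partial qs (partial_deriv p h) x) \<le> fact (length qs) * fps_nth (fps_deriv K) (length qs)"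
    if "\<And>qs. subseq qs (ps @ [p]) \<Longrightarrow> N (iter_partial qs h x) \<le> fact (length qs) * fps_nth K (length qs)"
      and "subseq qs ps" for N :: "complex \<Rightarrow> real" and h K qs
    using that(1)[of "qs @ [p]"] that(2)
    by (simp add: iter_partial_append fps_deriv_nth algebra_simps)
  have smooth: "smooth (partial_deriv p f)" "smooth (partial_deriv p g)"
    using snoc.prems by (auto intro: smooth_partial_deriv)
  have "partial_deriv p (\<lambda>z. cprod (f z) (g z)) =
      (\<lambda>z. cprod (f z) (partial_deriv p g z) + cprod (partial_deriv p f z) (g z))"
    using snoc.prems by (intro partial_deriv_eqI has_partial_cprod smooth_has_partial)
  then have "iter_partial (ps @ [p]) (\<lambda>z. cprod (f z) (g z)) x =
      iter_partial ps (\<lambda>z. cprod (f z) (partial_deriv p g z)) x +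
      iter_partial ps (\<lambda>z. cprod (partial_deriv p f z) (g z)) x"
    using snoc.prems smooth by (simp add: iter_partial_append iter_partial_add smooth_cprod)
  also have "norm \<dots> \<le> fact ?n * fps_nth (F * fps_deriv H) ?n + fact ?n * fps_nth (fps_deriv F * H) ?n"
    using snoc.prems smooth
    by (intro norm_triangle_mono snoc.IH) (auto intro: deriv_bound[where N = cmax] deriv_bound[where N = norm] subseq_rev_drop_many simp del: fps_deriv_nth)
  \<comment> \<open>The two summands recombine by the Leibniz rule for formal power series.\<close>
  also have "\<dots> = fact ?n * fps_nth (fps_deriv (F * H)) ?n"
    by (simp only: fps_deriv_mult fps_add_nth distrib_left)
  also have "\<dots> = fact (length (ps @ [p])) * fps_nth (F * H) (length (ps @ [p]))"
    by (simp add: fps_deriv_nth algebra_simps del: fps_deriv_mult)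
  finally show ?case .
qed

text \<open>The series \<open>F k\<close> plays the role of the \<open>k\<close>-th derivative of the majorant of the activation,
  composed with the majorant \<open>H\<close> of \<open>g\<close>.\<close>

lemma norm_iter_partial_complex_activation_le:
  assumes \<sigma>: "\<And>k t. (deriv ^^ k) \<sigma> field_differentiable (at t)" and g: "smooth g"
    and \<sigma>_bound: "\<And>k t. k \<ge> 1 \<Longrightarrow> \<bar>(deriv ^^ k) \<sigma> t\<bar> \<le> fps_nth (F k) 0"
    and F: "\<And>k. fps_deriv (F k) = F (Suc k) * fps_deriv H"
    and g_bound: "\<And>qs. subseq qs ps \<Longrightarrow> qs \<noteq> [] \<Longrightarrow>
      norm (iter_partial qs g x) \<le> fact (length qs) * fps_nth H (length qs)"
    and "k \<ge> 1 \<or> ps \<noteq> []"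
  shows "cmax (iter_partial ps (\<lambda>z. complex_activation ((deriv ^^ k) \<sigma>) (g z)) x)
           \<le> fact (length ps) * fps_nth (F k) (length ps)" (is ?A)
    and "ps \<noteq> [] \<Longrightarrow> norm (iter_partial ps (\<lambda>z. complex_activation ((deriv ^^ k) \<sigma>) (g z)) x)
           \<le> fact (length ps) * fps_nth (F k) (length ps)" (is "_ \<Longrightarrow> ?B")
proof -
  \<comment> \<open>Nonempty words are bounded in \<open>norm\<close>, which is stronger by
    \<open>cmax_le_norm\<close>; the empty word is bounded only in \<open>cmax\<close>, where the
    pointwise bound on the derivatives of \<sigma> passes to the complex activation without a
    constant.\<close>
  have main: "(ps = [] \<longrightarrow> ?A) \<and> (ps \<noteq> [] \<longrightarrow> ?B)"
    using g_bound \<open>k \<ge> 1 \<or> ps \<noteq> []\<close>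
  proof (induction ps arbitrary: k rule: length_induct)
    case (1 ps)
    show ?case
    proof (cases ps rule: rev_cases)
      case Nil
      then show ?thesis
        using 1(3) \<sigma>_bound by (auto simp: cmax_def complex_activation_def)
    next
      case (snoc qs p)
      let ?act = "\<lambda>k z. complex_activation ((deriv ^^ k) \<sigma>) (g z)"
      \<comment> \<open>The outer factor of the chain rule carries order \<open>Suc k\<close>, so
        the induction hypothesis applies to every shorter word, including the empty one.\<close>
      have act_bound: "cmax (iter_partial rs (?act (Suc k)) x) \<le> fact (length rs) * fps_nth (F (Suc k)) (length rs)"
        if "subseq rs qs" for rs
      proof -
        have "length rs < length ps"
          using list_emb_length[OF that] snoc by simp
        moreover have "subseq ts ps" if "subseq ts rs" for ts
          using that \<open>subseq rs qs\<close> snoc by (auto intro: subseq_rev_drop_many subseq_order.trans)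
        ultimately show ?thesis
          using 1(1)[rule_format, of rs "Suc k"] 1(2)
          by (cases "rs = []") (auto intro: order_trans[OF cmax_le_norm])
      qed
      have "partial_deriv p (?act k) = (\<lambda>z. cprod (?act (Suc k) z) (partial_deriv p g z))"
        using has_partial_complex_activation[OF \<sigma> smooth_has_partial[OF g]]
        by (intro partial_deriv_eqI) simp
      then have "norm (iter_partial ps (?act k) x) =
          norm (iter_partial qs (\<lambda>z. cprod (?act (Suc k) z) (partial_deriv p g z)) x)"
        by (simp add: snoc iter_partial_append)
      also have "\<dots> \<le> fact (length qs) * fps_nth (F (Suc k) * fps_deriv H) (length qs)"
      proof (rule norm_iter_partial_cprod_le[OF smooth_complex_activation[OF \<sigma> g]
            smooth_partial_deriv[OF g] act_bound])
        fix rs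
        assume "subseq rs qs"
        then show "norm (iter_partial rs (partial_deriv p g) x)
            \<le> fact (length rs) * fps_nth (fps_deriv H) (length rs)"
          using 1(2)[of "rs @ [p]"] snoc
          by (simp add: iter_partial_append fps_deriv_nth algebra_simps)
      qed
      \<comment> \<open>By \<open>F\<close> the product is \<open>fps_deriv (F k)\<close>; its index
        shift accounts for the removed letter.\<close>
      also have "\<dots> = fact (length ps) * fps_nth (F k) (length ps)"
        unfolding F[symmetric] by (simp add: snoc algebra_simps)
      finally show ?thesis
        using snoc by simp
    qed
  qed
  then show ?A
    using order_trans[OF cmax_le_norm] by (cases "ps = []") auto
  show ?B if "ps \<noteq> []"
    using main that by simp
qed

section \<open>Geometric power series and Moebius majorants\<close>

definition geom_fps :: "real \<Rightarrow> real fps" where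
  "geom_fps c = Abs_fps (\<lambda>n. c ^ n)"

lemma geom_fps_nth [simp]: "fps_nth (geom_fps c) n = c ^ n"
  by (simp add: geom_fps_def)

lemma geom_fps_mult: "geom_fps c * (1 - fps_const c * fps_X) = 1"
proof (rule fps_ext)
  fix n
  have "geom_fps c * (1 - fps_const c * fps_X) = geom_fps c - fps_const c * (fps_X * geom_fps c)"
    by (simp add: algebra_simps)
  then show "fps_nth (geom_fps c * (1 - fps_const c * fps_X)) n = fps_nth 1 n"
    by (cases n) simp_all
qed

text \<open>With E for the series, differentiating E (1 - c X) = 1 gives E' (1 - c X) = c E;
  multiplication by E isolates E'.\<close>

lemma fps_deriv_geom_fps: "fps_deriv (geom_fps c) = fps_const c * geom_fps c ^ 2"
proof -
  have "fps_deriv (geom_fps c * (1 - fps_const c * fps_X)) = 0"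
    by (simp only: geom_fps_mult) simp
  then have "fps_deriv (geom_fps c) * (1 - fps_const c * fps_X) = fps_const c * geom_fps c"
    by (simp add: algebra_simps)
  moreover have "fps_deriv (geom_fps c) * (geom_fps c * (1 - fps_const c * fps_X))
      = fps_deriv (geom_fps c) * (1 - fps_const c * fps_X) * geom_fps c"
    by (simp only: ac_simps)
  ultimately show ?thesis
    by (simp add: geom_fps_mult power2_eq_square mult.assoc)
qed

text \<open>The product rule leaves the factor 1 + \<beta> X E with E = 1 / (1 - \<beta> X), and
  this factor is E again.\<close>

lemma fps_deriv_mobius:
  "fps_deriv (fps_const \<alpha> * fps_X * geom_fps \<beta>) = fps_const \<alpha> * geom_fps \<beta> ^ 2"
proof -
  have *: "1 + fps_const \<beta> * fps_X * geom_fps \<beta> = geom_fps \<beta>"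
    using geom_fps_mult[of \<beta>] by (simp add: algebra_simps)
  have "fps_deriv (fps_const \<alpha> * fps_X * geom_fps \<beta>)
      = fps_const \<alpha> * geom_fps \<beta> * (1 + fps_const \<beta> * fps_X * geom_fps \<beta>)"
    by (simp add: fps_deriv_geom_fps power2_eq_square algebra_simps)
  then show ?thesis
    by (simp only: *) (simp only: power2_eq_square mult.assoc)
qed

text \<open>With \<open>q = (1 - \<beta> X) / (1 - \<beta>' X)\<close> and \<open>\<beta>' = \<beta> + \<tau> \<alpha>\<close>, the majorant \<open>H = \<alpha> X / (1 - \<beta> X)\<close> satisfies
  \<open>1 - \<tau> H = 1 / q\<close>, so that the \<open>k\<close>-th derivative of \<open>\<xi> / (1 - \<tau> u)\<close> at \<open>u = H\<close> is \<open>\<xi> \<tau>^k k! q^(k+1)\<close>.\<close>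

lemma fps_deriv_act_majorant:
  fixes \<alpha> \<beta> \<tau> \<xi> :: real
  defines "q \<equiv> (1 - fps_const \<beta> * fps_X) * geom_fps (\<beta> + \<tau> * \<alpha>)"
  shows "fps_deriv (fps_const (\<xi> * \<tau> ^ k * fact k) * q ^ Suc k) =
     fps_const (\<xi> * \<tau> ^ Suc k * fact (Suc k)) * q ^ Suc (Suc k) *
     fps_deriv (fps_const \<alpha> * fps_X * geom_fps \<beta>)"
proof -
  let ?E = "geom_fps \<beta>" and ?E' = "geom_fps (\<beta> + \<tau> * \<alpha>)"
  have 1: "(1 - fps_const \<beta> * fps_X) * ?E = 1" "?E' * (1 - fps_const (\<beta> + \<tau> * \<alpha>) * fps_X) = 1"
    using geom_fps_mult by (auto simp: mult.commute)
  \<comment> \<open>Since \<open>q * ?E = ?E'\<close>, the derivative of \<open>q\<close> computed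
    below is \<tau> q^2 H', the form that the chain rule needs.\<close>
  have "q ^ 2 * ?E ^ 2 = (((1 - fps_const \<beta> * fps_X) * ?E) * ?E') ^ 2"
    unfolding q_def by (simp only: power_mult_distrib ac_simps)
  then have q2: "q ^ 2 * ?E ^ 2 = ?E' ^ 2"
    by (simp add: 1)
  \<comment> \<open>The explicit \<open>1\<close> will be replaced by \<open>?E'\<close> times its
    inverse, so that both summands share the factor \<open>?E' ^ 2\<close> and the terms in
    \<open>fps_X\<close> cancel.\<close>
  have "fps_deriv q = - fps_const \<beta> * ?E' * 1 +
      (1 - fps_const \<beta> * fps_X) * (fps_const (\<beta> + \<tau> * \<alpha>) * ?E' ^ 2)"
    unfolding q_def by (simp add: fps_deriv_geom_fps algebra_simps)
      (simp flip: distrib_right)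
  also have "\<dots> = fps_const (\<tau> * \<alpha>) * ?E' ^ 2"
  proof -
    have "- fps_const \<beta> * ?E' * (?E' * (1 - fps_const (\<beta> + \<tau> * \<alpha>) * fps_X)) +
        (1 - fps_const \<beta> * fps_X) * (fps_const (\<beta> + \<tau> * \<alpha>) * ?E' ^ 2) =
        (fps_const (\<beta> + \<tau> * \<alpha>) - fps_const \<beta>) * ?E' ^ 2"
      by algebra
    then show ?thesis by (simp add: 1)
  qed
  finally have dq: "fps_deriv q = fps_const (\<tau> * \<alpha>) * ?E' ^ 2" .
  have "fps_deriv (fps_const (\<xi> * \<tau> ^ k * fact k) * q ^ Suc k) =
      fps_const (\<xi> * \<tau> ^ k * fact k) * (fps_const (of_nat (Suc k)) * fps_deriv q * q ^ k)"
    unfolding fps_deriv_mult fps_deriv_power fps_deriv_const diff_Suc_1 by simp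
  also have "\<dots> = fps_const (\<xi> * \<tau> ^ k * fact k) * fps_const (of_nat (Suc k)) * fps_const (\<tau> * \<alpha>)
      * (q ^ k * (q ^ 2 * ?E ^ 2))"
    unfolding dq q2 by (simp only: ac_simps)
  also have "fps_const (\<xi> * \<tau> ^ k * fact k) * fps_const (of_nat (Suc k)) * fps_const (\<tau> * \<alpha>) =
      fps_const (\<xi> * \<tau> ^ Suc k * fact (Suc k)) * fps_const \<alpha>"
    by (simp add: algebra_simps)
  also have "\<dots> * (q ^ k * (q ^ 2 * ?E ^ 2)) =
      fps_const (\<xi> * \<tau> ^ Suc k * fact (Suc k)) * q ^ Suc (Suc k) * (fps_const \<alpha> * ?E ^ 2)"
    by (simp only: power2_eq_square power_Suc ac_simps)
  finally show ?thesis
    by (simp only: fps_deriv_mobius)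
qed

text \<open>The series is 1 + \<tau> \<alpha> X / (1 - (\<beta> + \<tau> \<alpha>) X), so only the
  constant term falls outside the geometric pattern.\<close>

lemma act_majorant_nth:
  fixes \<alpha> \<beta> \<tau> :: real
  assumes "n \<noteq> 0"
  shows "fps_nth ((1 - fps_const \<beta> * fps_X) * geom_fps (\<beta> + \<tau> * \<alpha>)) n = \<tau> * \<alpha> * (\<beta> + \<tau> * \<alpha>) ^ (n - 1)"
proof -
  obtain m where n: "n = Suc m"
    using assms by (cases n) auto
  show ?thesis
    unfolding n by (simp add: left_diff_distrib mult.assoc) (simp add: algebra_simps)
qed

text \<open>The case \<open>k = 0\<close> of the chain rule estimate for the concrete majorants. The
  constant term of \<open>?q\<close> is 1, so \<open>?F k\<close> starts with exactly the bound
  assumed for the \<open>k\<close>-th derivative of \<sigma>, and \<open>?F 0\<close> = \<xi>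
  \<open>?q\<close> has the coefficients claimed.\<close>

lemma norm_iter_partial_activation_le:
  fixes \<xi> \<tau> \<alpha> \<beta> :: real
  assumes \<sigma>: "\<And>k t. (deriv ^^ k) \<sigma> field_differentiable (at t)" and g: "smooth g"
    and \<sigma>_bound: "\<And>k t. k \<ge> 1 \<Longrightarrow> \<bar>(deriv ^^ k) \<sigma> t\<bar> \<le> \<xi> * \<tau> ^ k * fact k"
    and g_bound: "\<And>qs. subseq qs ps \<Longrightarrow> qs \<noteq> [] \<Longrightarrow>
      norm (iter_partial qs g x) \<le> fact (length qs) * (\<alpha> * \<beta> ^ (length qs - 1))"
    and ps: "ps \<noteq> []"
  shows "norm (iter_partial ps (\<lambda>z. complex_activation \<sigma> (g z)) x)
           \<le> fact (length ps) * ((\<xi> * \<tau> * \<alpha>) * (\<beta> + \<tau> * \<alpha>) ^ (length ps - 1))"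
proof -
  let ?q = "(1 - fps_const \<beta> * fps_X) * geom_fps (\<beta> + \<tau> * \<alpha>)"
  let ?F = "\<lambda>k. fps_const (\<xi> * \<tau> ^ k * fact k) * ?q ^ Suc k"
  let ?H = "fps_const \<alpha> * fps_X * geom_fps \<beta>"
  have "norm (iter_partial ps (\<lambda>z. complex_activation ((deriv ^^ 0) \<sigma>) (g z)) x)
      \<le> fact (length ps) * fps_nth (?F 0) (length ps)"
  proof (rule norm_iter_partial_complex_activation_le(2)[where F = ?F and H = ?H, OF \<sigma> g _ fps_deriv_act_majorant])
    show "\<bar>(deriv ^^ k) \<sigma> t\<bar> \<le> fps_nth (?F k) 0" if "k \<ge> 1" for k t
      using \<sigma>_bound[OF that] by (simp add: fps_power_zeroth)
    show "norm (iter_partial qs g x) \<le> fact (length qs) * fps_nth ?H (length qs)"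
      if "subseq qs ps" "qs \<noteq> []" for qs
      using g_bound[OF that] that(2) by (cases qs) (auto simp: mult.assoc)
  qed (use ps in auto)
  moreover have "fps_nth (?F 0) (length ps) = (\<xi> * \<tau> * \<alpha>) * (\<beta> + \<tau> * \<alpha>) ^ (length ps - 1)"
    using ps by (simp add: act_majorant_nth mult.assoc)
  ultimately show ?thesis
    by (simp only: funpow_0)
qed

subsection \<open>Plane waves and Fourier coefficients\<close>

definition wave :: "int ^ 'd::finite \<Rightarrow> real ^ 'd \<Rightarrow> complex" where
  "wave h x = exp (2 * of_real pi * \<i> * of_real (freq_dot h x))"

text \<open>The eigenvalue of differentiation along \<open>p\<close> on the plane wave
  \<open>wave h\<close>.\<close>

definition freq :: "int ^ 'd \<Rightarrow> 'd \<Rightarrow> complex" where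
  "freq h p = 2 * of_real pi * \<i> * of_int (h $ p)"

definition periodic :: "(real ^ 'd::finite \<Rightarrow> complex) \<Rightarrow> bool" where
  "periodic f \<longleftrightarrow> (\<forall>p x. f (x + axis p 1) = f x)"

lemma norm_freq: "norm (freq h p) = 2 * pi * \<bar>real_of_int (h $ p)\<bar>"
  by (simp add: freq_def norm_mult)

lemma freq_dot_add_axis: "freq_dot h (x + t *\<^sub>R axis p 1) = freq_dot h x + t * real_of_int (h $ p)"
proof -
  have "freq_dot h (x + t *\<^sub>R axis p 1)
      = freq_dot h x + (\<Sum>q\<in>UNIV. if q = p then t * real_of_int (h $ q) else 0)"
    unfolding freq_dot_def sum.distrib[symmetric]
    by (intro sum.cong) (auto simp: axis_def algebra_simps)
  then show ?thesis by simp
qed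

lemma norm_wave [simp]: "norm (wave h x) = 1"
  by (simp add: wave_def norm_exp_eq_Re)

lemma wave_minus: "wave (- h) x = exp (- (2 * of_real pi * \<i> * of_real (freq_dot h x)))"
  by (simp add: wave_def freq_dot_def sum_negf)

lemma freq_minus: "freq (- h) p = - freq h p"
  by (simp add: freq_def)

lemma fourier_coeff_eq: "fourier_coeff v h = integral (cbox 0 1) (\<lambda>x. v x * wave (- h) x)"
  by (simp add: fourier_coeff_def wave_minus spatial_domain_def)

lemma has_partial_wave: "has_partial p (wave h) (\<lambda>x. freq h p * wave h x)"
  unfolding has_partial_def
proof
  fix x :: "real ^ 'a"
  have "((\<lambda>t. exp (t *\<^sub>R freq h p)) has_vector_derivative exp (0 *\<^sub>R freq h p) * freq h p) (at 0)"
    by (rule exp_scaleR_has_vector_derivative_right)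
  then have "((\<lambda>t. wave h x * exp (t *\<^sub>R freq h p)) has_vector_derivative wave h x * freq h p) (at 0)"
    by (intro has_vector_derivative_mult_right) simp
  moreover have "wave h (x + t *\<^sub>R axis p 1) = wave h x * exp (t *\<^sub>R freq h p)" for t
    unfolding wave_def freq_def freq_dot_add_axis exp_add[symmetric]
    by (simp add: scaleR_conv_of_real algebra_simps)
  ultimately show "((\<lambda>t. wave h (x + t *\<^sub>R axis p 1)) has_vector_derivative freq h p * wave h x) (at 0)"
    by (simp add: mult.commute)
qed

lemma smooth_wave: "smooth (wave h)"
proof -
  have cont: "continuous_on UNIV (wave h)"
    unfolding wave_def freq_dot_def by (intro continuous_intros)
  have "cn n (wave h)" for n
  proof (induction n)
    case (Suc n)
    then show ?case
      by (intro cn_SucI[OF cont has_partial_wave] cn_cmult)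
  qed (use cont in simp)
  then show ?thesis by (simp add: smooth_def)
qed

lemma periodic_wave: "periodic (wave h)"
  unfolding periodic_def
proof (intro allI)
  fix p x
  have "freq_dot h (x + axis p 1) = freq_dot h x + real_of_int (h $ p)"
    using freq_dot_add_axis[of h x 1 p] by simp
  then have "wave h (x + axis p 1) = wave h x * exp ((2 * of_int (h $ p) * of_real pi) * \<i>)"
    by (simp add: wave_def algebra_simps flip: exp_add)
  also have "\<dots> = wave h x"
    by (auto simp: exp_eq_1)
  finally show "wave h (x + axis p 1) = wave h x" .
qed

lemma iter_partial_wave: "iter_partial ps (wave h) = (\<lambda>x. prod_list (map (freq h) ps) * wave h x)"
proof (induction ps)
  case (Cons p ps)
  show ?case
    by (simp add: Cons partial_deriv_eqI[OF has_partial_cmult[OF has_partial_wave]] mult.assoc mult.left_commute)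
qed simp

lemma periodic_partial_deriv: "periodic f \<Longrightarrow> periodic (partial_deriv p f)"
  unfolding periodic_def
proof (intro allI)
  fix q x
  assume f: "\<forall>q x. f (x + axis q 1) = f x"
  have "f (x + axis q 1 + t *\<^sub>R axis p 1) = f (x + t *\<^sub>R axis p 1)" for t
    using f[rule_format, of "x + t *\<^sub>R axis p 1" q] by (simp add: ac_simps)
  then show "partial_deriv p f (x + axis q 1) = partial_deriv p f x"
    by (simp add: partial_deriv_def)
qed

lemma periodic_iter_partial: "periodic f \<Longrightarrow> periodic (iter_partial ps f)"
  by (induction ps) (auto intro: periodic_partial_deriv)

text \<open>The box lengthened to \<open>1 + t\<close> in direction \<open>p\<close> is cut in two
  ways: at 1 into the unit cube and a slab, at \<open>t\<close> into a slab and the shifted cube.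
  The two slabs differ by one period, so the cubes have equal integrals.\<close>

lemma integral_periodic_shift:
  fixes f :: "real ^ 'd::finite \<Rightarrow> complex"
  assumes f: "continuous_on UNIV f" "periodic f" and t: "0 \<le> t" "t \<le> 1"
  shows "integral (cbox 0 1) (\<lambda>x. f (x + t *\<^sub>R axis p 1)) = integral (cbox 0 1) f"
proof -
  let ?e = "axis p 1 :: real ^ 'd"
  have int: "f integrable_on cbox a b" for a b
    using f(1) by (intro integrable_continuous) (auto intro: continuous_on_subset)
  have [simp]: "x \<bullet> ?e = x $ p" for x
    by (simp add: inner_axis)
  \<comment> \<open>The constraints in the other directions are common to all boxes, so each
    membership reduces to an interval condition on \<open>x $ p\<close>.\<close>
  define rest where "rest x \<longleftrightarrow> (\<forall>i. i \<noteq> p \<longrightarrow> 0 \<le> x $ i \<and> x $ i \<le> 1)" for x :: "real ^ 'd"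
  have mem: "x \<in> cbox (u *\<^sub>R ?e) (1 + w *\<^sub>R ?e) \<longleftrightarrow> u \<le> x $ p \<and> x $ p \<le> 1 + w \<and> rest x" for x u w
  proof -
    have *: "(u *\<^sub>R ?e) $ i = (if i = p then u else 0)" "(1 + w *\<^sub>R ?e) $ i = (if i = p then 1 + w else 1)" for i
      by (auto simp: axis_def)
    have split: "(\<forall>i. Q i) \<longleftrightarrow> Q p \<and> (\<forall>i. i \<noteq> p \<longrightarrow> Q i)" for Q :: "'d \<Rightarrow> bool"
      by metis
    show ?thesis
      unfolding mem_box_cart * rest_def by (rule trans[OF split]) auto
  qed
  \<comment> \<open>The five instances of \<open>mem\<close> describe, in order, the cube, the
    lengthened box, the slab beyond 1, the slab below \<open>t\<close> and the shifted cube.\<close>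
  have "x \<in> cbox 0 (1 + t *\<^sub>R ?e) \<inter> {x. x \<bullet> ?e \<le> 1} \<longleftrightarrow> x \<in> cbox 0 1"
    and "x \<in> cbox 0 (1 + t *\<^sub>R ?e) \<inter> {x. x \<bullet> ?e \<ge> 1} \<longleftrightarrow> x \<in> cbox ?e (1 + t *\<^sub>R ?e)"
    and "x \<in> cbox 0 (1 + t *\<^sub>R ?e) \<inter> {x. x \<bullet> ?e \<le> t} \<longleftrightarrow> x \<in> cbox 0 (1 + t *\<^sub>R ?e - ?e)"
    and "x \<in> cbox 0 (1 + t *\<^sub>R ?e) \<inter> {x. x \<bullet> ?e \<ge> t} \<longleftrightarrow> x \<in> cbox (t *\<^sub>R ?e) (1 + t *\<^sub>R ?e)" for x
    using t mem[of x 0 0] mem[of x 0 t] mem[of x 1 t] mem[of x 0 "t - 1"] mem[of x t t]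
    unfolding scaleR_left_diff_distrib
    by (auto simp: add_diff_eq)
  then have box: "cbox 0 (1 + t *\<^sub>R ?e) \<inter> {x. x \<bullet> ?e \<le> 1} = cbox 0 1"
    "cbox 0 (1 + t *\<^sub>R ?e) \<inter> {x. x \<bullet> ?e \<ge> 1} = cbox ?e (1 + t *\<^sub>R ?e)"
    "cbox 0 (1 + t *\<^sub>R ?e) \<inter> {x. x \<bullet> ?e \<le> t} = cbox 0 (1 + t *\<^sub>R ?e - ?e)"
    "cbox 0 (1 + t *\<^sub>R ?e) \<inter> {x. x \<bullet> ?e \<ge> t} = cbox (t *\<^sub>R ?e) (1 + t *\<^sub>R ?e)"
    by blast+
  have "integral (cbox 0 1) (\<lambda>x. f (x + t *\<^sub>R ?e)) = integral (cbox (t *\<^sub>R ?e) (1 + t *\<^sub>R ?e)) f"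
    using integral_shift_cbox[of "t *\<^sub>R ?e" "t *\<^sub>R ?e" "1 + t *\<^sub>R ?e" f] by simp
  also have "\<dots> = integral (cbox 0 (1 + t *\<^sub>R ?e)) f - integral (cbox 0 (1 + t *\<^sub>R ?e - ?e)) f"
    using integral_split[OF int, of ?e 0 "1 + t *\<^sub>R ?e" t] by (simp only: box) simp
  also have "integral (cbox 0 (1 + t *\<^sub>R ?e - ?e)) f = integral (cbox ?e (1 + t *\<^sub>R ?e)) f"
    using integral_shift_cbox[of ?e ?e "1 + t *\<^sub>R ?e" f] f(2) by (simp add: periodic_def)
  also have "integral (cbox 0 (1 + t *\<^sub>R ?e)) f - \<dots> = integral (cbox 0 1) f"
    using integral_split[OF int, of ?e 0 "1 + t *\<^sub>R ?e" 1] by (simp only: box) simp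
  finally show ?thesis .
qed

text \<open>The integral over the shifted cube does not depend on the shift, while the Leibniz rule
  gives its derivative at 0 as the integral of \<open>f'\<close>. Constancy is known for shifts in
  [0, 1], so derivatives within that interval are compared.\<close>

lemma integral_partial_eq_0:
  fixes f :: "real ^ 'd::finite \<Rightarrow> complex"
  assumes f: "continuous_on UNIV f" "periodic f" and f': "has_partial p f f'" "continuous_on UNIV f'"
  shows "integral (cbox 0 1) f' = 0"
proof -
  let ?I = "\<lambda>t. integral (cbox 0 1) (\<lambda>x. f (x + t *\<^sub>R axis p 1))"
  have "(?I has_vector_derivative integral (cbox 0 1) (\<lambda>x. f' (x + 0 *\<^sub>R axis p 1))) (at 0 within {0..1})"
  proof (rule leibniz_rule_vector_derivative)
    show "((\<lambda>t. f (x + t *\<^sub>R axis p 1)) has_vector_derivative f' (x + t *\<^sub>R axis p 1)) (at t within {0..1})"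
      for t x
      by (rule has_partial_along_line[OF f'(1)])
    show "(\<lambda>x. f (x + t *\<^sub>R axis p 1)) integrable_on cbox 0 1" for t
      by (intro integrable_continuous continuous_on_compose2[OF f(1)] continuous_intros) auto
    show "continuous_on ({0..1} \<times> cbox 0 1) (\<lambda>(t, x). f' (x + t *\<^sub>R axis p 1))"
      unfolding split_beta by (intro continuous_on_compose2[OF f'(2)] continuous_intros) auto
  qed auto
  moreover have "(?I has_vector_derivative 0) (at 0 within {0..1})"
    by (rule has_vector_derivative_transform[OF _ _ has_vector_derivative_const[where c = "integral (cbox 0 1) f"]])
      (use integral_periodic_shift[OF f] in auto)
  ultimately show ?thesis
    using vector_derivative_unique_within_closed_interval[of 0 1 0 ?I] by force
qed

text \<open>Integration by parts without boundary terms: the derivative of the periodic function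
  \<open>v\<close> times \<open>wave (- h)\<close> has integral 0.\<close>

lemma fourier_coeff_partial:
  assumes v: "smooth v" "periodic v"
  shows "fourier_coeff (partial_deriv p v) h = freq h p * fourier_coeff v h"
proof -
  let ?v' = "partial_deriv p v" and ?w = "wave (- h)"
  have cont: "continuous_on S v" "continuous_on S ?v'" "continuous_on S ?w" for S
    using v by (auto intro: smooth_continuous smooth_partial_deriv smooth_wave)
  have "integral (cbox 0 1) (\<lambda>x. v x * (freq (- h) p * ?w x) + ?v' x * ?w x) = 0"
  proof (rule integral_partial_eq_0)
    show "has_partial p (\<lambda>x. v x * ?w x) (\<lambda>x. v x * (freq (- h) p * ?w x) + ?v' x * ?w x)"
      by (intro has_partial_mult smooth_has_partial has_partial_wave v)
    show "periodic (\<lambda>x. v x * ?w x)"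
      using v periodic_wave[of "- h"] by (simp add: periodic_def)
  qed (intro continuous_intros cont)+
  also have "(\<lambda>x. v x * (freq (- h) p * ?w x) + ?v' x * ?w x) =
      (\<lambda>x. - freq h p * (v x * ?w x) + ?v' x * ?w x)"
    by (simp add: freq_minus algebra_simps)
  also have "integral (cbox 0 1) \<dots> = - freq h p * fourier_coeff v h + fourier_coeff ?v' h"
    unfolding fourier_coeff_eq
    by (subst integral_add) (auto intro!: integrable_continuous continuous_intros cont)
  finally show ?thesis
    by (simp add: add_eq_0_iff algebra_simps)
qed

text \<open>The wave has modulus 1 and the cube has volume 1, so no constant appears.\<close>

lemma norm_fourier_coeff_le:
  assumes "continuous_on UNIV v" "\<And>x. norm (v x) \<le> B"
  shows "norm (fourier_coeff v h) \<le> B"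
proof -
  have B: "0 \<le> B"
    using norm_ge_zero order_trans assms(2) by blast
  have "(\<lambda>x. v x * wave (- h) x) integrable_on cbox 0 1"
    by (intro integrable_continuous continuous_intros smooth_continuous[OF smooth_wave]
        continuous_on_subset[OF assms(1)]) auto
  then have "norm (fourier_coeff v h) \<le> B * measure lborel (cbox 0 (1 :: real ^ 'a))"
    unfolding fourier_coeff_eq
    by (intro has_integral_bound[OF B integrable_integral]) (auto simp: norm_mult assms(2))
  also have "measure lborel (cbox 0 (1 :: real ^ 'a)) = 1"
    by (simp add: content_cbox_if_cart interval_ne_empty_cart)
  finally show ?thesis by simp
qed

subsection \<open>Propagation of derivative bounds through the layers\<close>

lemma fno_layer_eq:
  "fno_layer \<A> n W K b v x i =
     (\<Sum>j=1..n. of_real (W i j) * v x j) +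
     (\<Sum>h\<in>\<A>. (\<Sum>j=1..n. K h i j * fourier_coeff (\<lambda>z. v z j) h) * wave h x) + of_real (b i)"
  by (simp add: fno_layer_def kernel_op_def wave_def)

lemma smooth_fno_layer:
  assumes "\<And>j. smooth (\<lambda>x. v x j)"
  shows "smooth (\<lambda>x. fno_layer \<A> n W K b v x i)"
  unfolding fno_layer_eq
  by (intro smooth_add smooth_sum smooth_cmult smooth_const smooth_wave assms)

lemma periodic_fno_layer:
  assumes "\<And>j. periodic (\<lambda>x. v x j)"
  shows "periodic (\<lambda>x. fno_layer \<A> n W K b v x i)"
  using assms by (simp add: periodic_def fno_layer_eq periodic_wave[unfolded periodic_def, rule_format])

text \<open>Differentiating the wave in the spectral part produces \<open>freq h p\<close>, which is
  absorbed into the Fourier coefficient of the derivative of \<open>v\<close>. Hence derivatives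
  pass through the layer to its input, and only the bias is lost.\<close>

lemma has_partial_fno_layer:
  assumes "\<And>j. smooth (\<lambda>x. v x j)" "\<And>j. periodic (\<lambda>x. v x j)"
  shows "has_partial p (\<lambda>x. fno_layer \<A> n W K b v x i)
           (\<lambda>x. fno_layer \<A> n W K (\<lambda>_. 0) (\<lambda>x j. partial_deriv p (\<lambda>z. v z j) x) x i)"
proof -
  have "has_partial p (\<lambda>x. fno_layer \<A> n W K b v x i)
      (\<lambda>x. (\<Sum>j=1..n. of_real (W i j) * partial_deriv p (\<lambda>z. v z j) x) +
     (\<Sum>h\<in>\<A>. (\<Sum>j=1..n. K h i j * fourier_coeff (\<lambda>z. v z j) h) * (freq h p * wave h x)) + 0)"
    unfolding fno_layer_eq
    by (intro has_partial_add has_partial_sum has_partial_cmult has_partial_const has_partial_wave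
        smooth_has_partial assms)
  also have "(\<lambda>x. (\<Sum>j=1..n. of_real (W i j) * partial_deriv p (\<lambda>z. v z j) x) +
     (\<Sum>h\<in>\<A>. (\<Sum>j=1..n. K h i j * fourier_coeff (\<lambda>z. v z j) h) * (freq h p * wave h x)) + 0) =
     (\<lambda>x. fno_layer \<A> n W K (\<lambda>_. 0) (\<lambda>x j. partial_deriv p (\<lambda>z. v z j) x) x i)"
    by (simp add: fno_layer_eq fourier_coeff_partial[OF assms] sum_distrib_left sum_distrib_right ac_simps)
  finally show ?thesis .
qed

lemma iter_partial_fno_layer:
  assumes "\<And>j. smooth (\<lambda>x. v x j)" "\<And>j. periodic (\<lambda>x. v x j)"
  shows "iter_partial ps (\<lambda>x. fno_layer \<A> n W K b v x i) =
     (\<lambda>x. fno_layer \<A> n W K (if ps = [] then b else (\<lambda>_. 0)) (\<lambda>x j. iter_partial ps (\<lambda>z. v z j) x) x i)"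
proof (induction ps)
  case (Cons p ps)
  have "smooth (\<lambda>x. iter_partial ps (\<lambda>z. v z j) x)" "periodic (\<lambda>x. iter_partial ps (\<lambda>z. v z j) x)" for j
    using assms by (auto intro: smooth_iter_partial periodic_iter_partial)
  then show ?case
    by (simp add: Cons partial_deriv_eqI[OF has_partial_fno_layer])
qed simp

lemma row_sum_le_mat_inf_norm:
  "i \<in> {1..m} \<Longrightarrow> (\<Sum>j=1..n. norm (A i j)) \<le> mat_inf_norm m n A"
  unfolding mat_inf_norm_def by (intro Max_ge) auto

lemma mat_inf_norm_nonneg: "m > 0 \<Longrightarrow> 0 \<le> mat_inf_norm m n A"
  using row_sum_le_mat_inf_norm[of 1 m A n] sum_nonneg[of "{1..n}" "\<lambda>j. norm (A 1 j)"] by simp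

text \<open>Row sums control both parts: the Fourier coefficients of \<open>v\<close> obey the same
  bound \<open>B\<close> as its values, and multiplying by a wave preserves the modulus.\<close>

lemma norm_fno_layer_le:
  assumes i: "i \<in> {1..m}" and B: "0 \<le> B"
    and v: "\<And>j. continuous_on UNIV (\<lambda>x. v x j)" "\<And>j x. j \<in> {1..n} \<Longrightarrow> norm (v x j) \<le> B"
  shows "norm (fno_layer \<A> n W K (\<lambda>_. 0) v x i)
           \<le> (mat_inf_norm m n W + (\<Sum>h\<in>\<A>. mat_inf_norm m n (K h))) * B"
proof -
  have row: "norm (\<Sum>j=1..n. c j * w j) \<le> (\<Sum>j=1..n. norm (c j)) * B"
    if "\<And>j. j \<in> {1..n} \<Longrightarrow> norm (w j) \<le> B" for c w :: "nat \<Rightarrow> complex"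
    unfolding sum_distrib_right by (intro sum_norm_le) (auto simp: norm_mult intro!: mult_left_mono that)
  have "norm (fno_layer \<A> n W K (\<lambda>_. 0) v x i) \<le>
      norm (\<Sum>j=1..n. of_real (W i j) * v x j) +
      norm (\<Sum>h\<in>\<A>. (\<Sum>j=1..n. K h i j * fourier_coeff (\<lambda>z. v z j) h) * wave h x)"
    unfolding fno_layer_eq using norm_triangle_ineq by simp
  also have "\<dots> \<le> mat_inf_norm m n W * B + (\<Sum>h\<in>\<A>. mat_inf_norm m n (K h) * B)"
  proof (intro add_mono sum_norm_le)
    show "norm (\<Sum>j=1..n. of_real (W i j) * v x j) \<le> mat_inf_norm m n W * B"
    proof (rule order_trans[OF row])
      show "(\<Sum>j=1..n. norm (of_real (W i j) :: complex)) * B \<le> mat_inf_norm m n W * B"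
        using mult_right_mono[OF row_sum_le_mat_inf_norm[OF i, of W n] B] by simp
    qed (rule v(2))
    show "norm ((\<Sum>j=1..n. K h i j * fourier_coeff (\<lambda>z. v z j) h) * wave h x)
        \<le> mat_inf_norm m n (K h) * B" for h
      unfolding norm_mult norm_wave mult_1_right
      by (rule order_trans[OF row mult_right_mono[OF row_sum_le_mat_inf_norm[OF i] B]])
        (rule norm_fourier_coeff_le[OF v])
  qed
  finally show ?thesis
    by (simp add: distrib_right sum_distrib_right)
qed

text \<open>The majorant \<alpha> t / (1 - \<beta> t) restricted to the words in \<open>adm\<close>,
  those for which the input field can be controlled. Leaving out the empty word keeps biases and the
  values of \<sigma> itself out of the estimates.\<close>

definition deriv_bounded ::
  "('d::finite list \<Rightarrow> bool) \<Rightarrow> real \<Rightarrow> real \<Rightarrow> (real ^ 'd \<Rightarrow> complex) \<Rightarrow> bool" where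
  "deriv_bounded adm \<alpha> \<beta> f \<longleftrightarrow> (\<forall>ps x. adm ps \<longrightarrow> ps \<noteq> [] \<longrightarrow>
     norm (iter_partial ps f x) \<le> fact (length ps) * (\<alpha> * \<beta> ^ (length ps - 1)))"

lemma deriv_boundedD:
  "deriv_bounded adm \<alpha> \<beta> f \<Longrightarrow> adm ps \<Longrightarrow> ps \<noteq> [] \<Longrightarrow>
   norm (iter_partial ps f x) \<le> fact (length ps) * (\<alpha> * \<beta> ^ (length ps - 1))"
  by (simp add: deriv_bounded_def)

lemma deriv_bounded_activation:
  fixes \<xi> \<tau> \<alpha> \<beta> :: real
  assumes "\<And>k t. (deriv ^^ k) \<sigma> field_differentiable (at t)"
    and "\<And>k t. k \<ge> 1 \<Longrightarrow> \<bar>(deriv ^^ k) \<sigma> t\<bar> \<le> \<xi> * \<tau> ^ k * fact k"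
    and adm: "\<And>ps qs. adm ps \<Longrightarrow> subseq qs ps \<Longrightarrow> adm qs"
    and g: "smooth g" "deriv_bounded adm \<alpha> \<beta> g"
  shows "deriv_bounded adm (\<xi> * \<tau> * \<alpha>) (\<beta> + \<tau> * \<alpha>) (\<lambda>z. complex_activation \<sigma> (g z))"
  unfolding deriv_bounded_def
proof (intro allI impI)
  fix ps x assume ps: "adm ps" "ps \<noteq> []"
  show "norm (iter_partial ps (\<lambda>z. complex_activation \<sigma> (g z)) x)
      \<le> fact (length ps) * (\<xi> * \<tau> * \<alpha> * (\<beta> + \<tau> * \<alpha>) ^ (length ps - 1))"
    by (rule norm_iter_partial_activation_le[OF assms(1) g(1) assms(2) _ ps(2)])
      (assumption, rule deriv_boundedD[OF g(2) adm[OF ps(1)]])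
qed

text \<open>The bias vanishes for nonempty words, and the remaining linear map scales the bounds of
  all orders alike, so \<beta> stays unchanged.\<close>

lemma deriv_bounded_fno_layer:
  assumes i: "i \<in> {1..m}" and \<alpha>: "0 \<le> \<alpha>" and \<beta>: "0 \<le> \<beta>"
    and R: "mat_inf_norm m n W + (\<Sum>h\<in>\<A>. mat_inf_norm m n (K h)) \<le> R"
    and v: "\<And>j. smooth (\<lambda>x. v x j)" "\<And>j. periodic (\<lambda>x. v x j)"
      "\<And>j. j \<in> {1..n} \<Longrightarrow> deriv_bounded adm \<alpha> \<beta> (\<lambda>x. v x j)"
  shows "deriv_bounded adm (R * \<alpha>) \<beta> (\<lambda>x. fno_layer \<A> n W K b v x i)"
  unfolding deriv_bounded_def
proof (intro allI impI)
  fix ps x assume ps: "adm ps" "ps \<noteq> []"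
  let ?B = "fact (length ps) * (\<alpha> * \<beta> ^ (length ps - 1))"
  have "norm (iter_partial ps (\<lambda>x. fno_layer \<A> n W K b v x i) x)
      = norm (fno_layer \<A> n W K (\<lambda>_. 0) (\<lambda>x j. iter_partial ps (\<lambda>z. v z j) x) x i)"
    using ps(2) by (simp add: iter_partial_fno_layer v)
  also have "\<dots> \<le> (mat_inf_norm m n W + (\<Sum>h\<in>\<A>. mat_inf_norm m n (K h))) * ?B"
    using \<alpha> \<beta> ps v
    by (intro norm_fno_layer_le i) (auto intro: smooth_continuous smooth_iter_partial deriv_boundedD simp del: One_nat_def)
  also have "\<dots> \<le> R * ?B"
    using R \<alpha> \<beta> by (intro mult_right_mono) auto
  finally show "norm (iter_partial ps (\<lambda>x. fno_layer \<A> n W K b v x i) x)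
      \<le> fact (length ps) * (R * \<alpha> * \<beta> ^ (length ps - 1))"
    by (simp add: ac_simps)
qed

lemma smooth_periodic_fno_pre:
  assumes \<sigma>: "\<And>k t. (deriv ^^ k) \<sigma> field_differentiable (at t)" and u: "smooth u" "periodic u"
  shows "smooth (\<lambda>x. fno_pre \<A> dims \<sigma> P W K b u l x i) \<and>
         periodic (\<lambda>x. fno_pre \<A> dims \<sigma> P W K b u l x i)"
proof (induction l arbitrary: i)
  case 0
  then show ?case by (simp add: smooth_const periodic_def)
next
  case (Suc l)
  let ?v = "if l = 0 then (\<lambda>x i. of_real (P i 1) * u x)
    else (\<lambda>x i. complex_activation \<sigma> (fno_pre \<A> dims \<sigma> P W K b u l x i))"
  have "smooth (\<lambda>x. complex_activation \<sigma> (fno_pre \<A> dims \<sigma> P W K b u l x j))" for j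
    using smooth_complex_activation[OF \<sigma>, of "\<lambda>x. fno_pre \<A> dims \<sigma> P W K b u l x j" 0] Suc by simp
  then have "smooth (\<lambda>x. ?v x j)" for j
    by (cases "l = 0") (simp_all add: smooth_cmult u)
  moreover have "periodic (\<lambda>x. ?v x j)" for j
    using u Suc by (auto simp: periodic_def)
  ultimately show ?case
    unfolding fno_pre.simps using smooth_fno_layer periodic_fno_layer by blast
qed

text \<open>Iteration of the map from (\<alpha>, \<beta>) to (\<xi> \<tau> R \<alpha>, \<beta> +
  \<tau> R \<alpha>), one step per layer. In the application \<open>B\<close> is
  \<parallel>P\<parallel> J.\<close>

lemma deriv_bounded_fno_pre:
  fixes \<xi> \<tau> B :: real and \<Lambda> R :: "nat \<Rightarrow> real"
  assumes \<sigma>: "\<And>k t. (deriv ^^ k) \<sigma> field_differentiable (at t)"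
    and \<sigma>_bound: "\<And>k t. k \<ge> 1 \<Longrightarrow> \<bar>(deriv ^^ k) \<sigma> t\<bar> \<le> \<xi> * \<tau> ^ k * fact k"
    and adm: "\<And>ps qs. adm ps \<Longrightarrow> subseq qs ps \<Longrightarrow> adm qs"
    and u: "smooth u" "periodic u"
    and B: "0 \<le> B" "\<And>i. i \<in> {1..dims 1} \<Longrightarrow> deriv_bounded adm (2 * pi * B) (2 * pi) (\<lambda>x. of_real (P i 1) * u x)"
    and pos: "\<xi> > 0" "\<tau> > 0" "\<And>l. l \<ge> 1 \<Longrightarrow> R l > 0"
    and R: "\<And>l. l \<in> {1..L} \<Longrightarrow>
              mat_inf_norm (dims (l + 1)) (dims l) (W l)
                + (\<Sum>h\<in>\<A>. mat_inf_norm (dims (l + 1)) (dims l) (K l h)) \<le> R l"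
    and \<Lambda>: "\<And>k. \<Lambda> k = (\<Prod>t=1..k. \<xi> * \<tau> * R t)"
    and l: "l \<in> {1..L}" "i \<in> {1..dims (l + 1)}"
  shows "deriv_bounded adm (2 * pi * B * \<Lambda> l) (2 * pi * (1 + B / \<xi> * (\<Sum>k=1..l. \<Lambda> k)))
           (\<lambda>x. complex_activation \<sigma> (fno_pre \<A> dims \<sigma> P W K b u l x i))"
  using l
proof (induction l arbitrary: i)
  case (Suc l)
  \<comment> \<open>The majorant of the input of layer \<open>Suc l\<close>. For
    \<open>l = 0\<close> the empty product and the empty sum reduce it to the one assumed for the
    lifted field.\<close>
  define \<alpha> where "\<alpha> = 2 * pi * B * \<Lambda> l"
  define \<beta> where "\<beta> = 2 * pi * (1 + B / \<xi> * (\<Sum>k=1..l. \<Lambda> k))"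
  have \<Lambda>_pos: "\<Lambda> k > 0" for k
    unfolding \<Lambda> using pos by (intro prod_pos) auto
  have nonneg: "0 \<le> \<alpha>" "0 \<le> \<beta>"
    unfolding \<alpha>_def \<beta>_def using B(1) pos \<Lambda>_pos
    by (simp_all add: less_imp_le sum_nonneg)
  let ?v = "if l = 0 then (\<lambda>x i. of_real (P i 1) * u x)
    else (\<lambda>x i. complex_activation \<sigma> (fno_pre \<A> dims \<sigma> P W K b u l x i))"
  note pre = smooth_periodic_fno_pre[OF \<sigma> u, where \<A> = \<A> and dims = dims and P = P and W = W and K = K and b = b]
  have "smooth (\<lambda>x. complex_activation \<sigma> (fno_pre \<A> dims \<sigma> P W K b u l x j))" for j
    using smooth_complex_activation[OF \<sigma>, of "\<lambda>x. fno_pre \<A> dims \<sigma> P W K b u l x j" 0] pre by simp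
  then have v1: "smooth (\<lambda>x. ?v x j)" for j
    by (cases "l = 0") (simp_all add: smooth_cmult u)
  have v2: "periodic (\<lambda>x. ?v x j)" for j
    using u pre[of l] by (auto simp: periodic_def)
  have v3: "deriv_bounded adm \<alpha> \<beta> (\<lambda>x. ?v x j)" if "j \<in> {1..dims (Suc l)}" for j
  proof (cases "l = 0")
    case True
    then show ?thesis
      using B(2)[of j] that by (simp add: \<alpha>_def \<beta>_def \<Lambda>)
  next
    case False
    then show ?thesis
      using Suc.IH[of j] Suc.prems that by (simp add: \<alpha>_def \<beta>_def)
  qed
  have "deriv_bounded adm (R (Suc l) * \<alpha>) \<beta> (\<lambda>x. fno_pre \<A> dims \<sigma> P W K b u (Suc l) x i)"
    unfolding fno_pre.simps
  proof (rule deriv_bounded_fno_layer[OF _ nonneg _ v1 v2 v3])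
    show "i \<in> {1..dims (Suc l + 1)}"
      using Suc.prems by simp
    show "mat_inf_norm (dims (Suc l + 1)) (dims (Suc l)) (W (Suc l))
        + (\<Sum>h\<in>\<A>. mat_inf_norm (dims (Suc l + 1)) (dims (Suc l)) (K (Suc l) h)) \<le> R (Suc l)"
      using Suc.prems by (intro R)
  qed
  then have "deriv_bounded adm (\<xi> * \<tau> * (R (Suc l) * \<alpha>)) (\<beta> + \<tau> * (R (Suc l) * \<alpha>))
      (\<lambda>x. complex_activation \<sigma> (fno_pre \<A> dims \<sigma> P W K b u (Suc l) x i))"
    using pre[of "Suc l" i] by (intro deriv_bounded_activation[OF \<sigma> \<sigma>_bound adm]) blast+
  moreover have \<Lambda>_Suc: "\<Lambda> (Suc l) = \<Lambda> l * (\<xi> * \<tau> * R (Suc l))"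
    unfolding \<Lambda> by simp
  then have "\<xi> * \<tau> * (R (Suc l) * \<alpha>) = 2 * pi * B * \<Lambda> (Suc l)"
    by (simp add: \<alpha>_def)
  \<comment> \<open>The increment of \<beta> lacks one factor \<xi> compared with the new \<alpha>;
    this is the origin of the division by \<xi> in front of the sum.\<close>
  moreover have "\<beta> + \<tau> * (R (Suc l) * \<alpha>) = 2 * pi * (1 + B / \<xi> * (\<Sum>k=1..Suc l. \<Lambda> k))"
    using pos(1) by (simp add: \<alpha>_def \<beta>_def \<Lambda>_Suc field_simps)
  ultimately show ?case
    by simp
qed simp

subsection \<open>Words of differentiations\<close>

lemma count_list_subseq: "subseq qs ps \<Longrightarrow> count_list qs p \<le> count_list ps p"
  by (induction rule: list_emb.induct) auto

lemma count_list_multi_axes: "distinct axs \<Longrightarrow> count_list (multi_axes axs \<nu>) q \<le> \<nu> $ q"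
proof -
  have rep: "count_list (replicate n p) q = (if p = q then n else 0)" for n p
    by (induction n) auto
  assume "distinct axs"
  then have "count_list (multi_axes axs \<nu>) q = (if q \<in> set axs then \<nu> $ q else 0)"
    by (induction axs) (auto simp: multi_axes_def rep)
  then show ?thesis by simp
qed

lemma length_multi_axes:
  assumes "distinct axs" "set axs = UNIV"
  shows "length (multi_axes axs \<nu>) = multi_abs \<nu>"
  using assms sum_list_distinct_conv_sum_set[of axs "\<lambda>p. \<nu> $ p"]
  by (simp add: multi_axes_def multi_abs_def length_concat o_def)

lemma prod_list_map_eq_prod_count_list:
  fixes f :: "'d::finite \<Rightarrow> 'a::comm_monoid_mult"
  shows "prod_list (map f ps) = (\<Prod>p\<in>UNIV. f p ^ count_list ps p)"
proof (induction ps)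
  case (Cons q ps)
  have "(\<Prod>p\<in>UNIV. f p ^ count_list (q # ps) p) =
      (\<Prod>p\<in>UNIV. (if p = q then f p else 1) * f p ^ count_list ps p)"
    by (intro prod.cong) auto
  then show ?case
    by (simp add: prod.distrib Cons)
qed simp

text \<open>A nonzero integer has modulus at least 1, so its exponent may be raised to \<omega>. A
  zero component contributes 0 or \<open>0 ^ 0 = 1\<close>, hence at most the factor 1 it has
  outside the support.\<close>

lemma prod_list_abs_le:
  fixes h :: "int ^ 'd::finite"
  assumes "\<And>p. real (count_list ps p) \<le> \<omega>"
  shows "prod_list (map (\<lambda>p. \<bar>real_of_int (h $ p)\<bar>) ps) \<le> (\<Prod>p\<in>supp h. \<bar>real_of_int (h $ p)\<bar> powr \<omega>)"
proof -
  have "prod_list (map (\<lambda>p. \<bar>real_of_int (h $ p)\<bar>) ps) = (\<Prod>p\<in>UNIV. \<bar>real_of_int (h $ p)\<bar> ^ count_list ps p)"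
    by (rule prod_list_map_eq_prod_count_list)
  also have "\<dots> \<le> (\<Prod>p\<in>UNIV. if p \<in> supp h then \<bar>real_of_int (h $ p)\<bar> powr \<omega> else 1)"
  proof (intro prod_mono conjI)
    fix p
    show "\<bar>real_of_int (h $ p)\<bar> ^ count_list ps p \<le> (if p \<in> supp h then \<bar>real_of_int (h $ p)\<bar> powr \<omega> else 1)"
    proof (cases "h $ p = 0")
      case True
      then show ?thesis by (simp add: supp_def power_0_left)
    next
      case False
      then have "1 \<le> \<bar>real_of_int (h $ p)\<bar>" by linarith
      then have "\<bar>real_of_int (h $ p)\<bar> powr real (count_list ps p) \<le> \<bar>real_of_int (h $ p)\<bar> powr \<omega>"
        using assms by (intro powr_mono) auto
      then show ?thesis
        using False by (simp add: supp_def powr_realpow)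
    qed
  qed auto
  also have "\<dots> = (\<Prod>p\<in>supp h. \<bar>real_of_int (h $ p)\<bar> powr \<omega>)"
    by (simp add: prod.If_cases)
  finally show ?thesis .
qed

subsection \<open>The input field\<close>

text \<open>The radius is nondecreasing along the enumeration, so the indices with radius at most
  \<open>M\<close> form an initial segment, whose length is the cardinality of the sublevel
  set.\<close>

lemma image_enumeration_eq_sublevel:
  fixes r :: "'a \<Rightarrow> real"
  assumes hs: "bij_betw hs {1..} (UNIV :: 'a set)" and mono: "\<And>j. j \<ge> 1 \<Longrightarrow> r (hs j) \<le> r (hs (Suc j))"
    and fin: "finite {h. r h \<le> M}"
  shows "bij_betw hs {1..card {h. r h \<le> M}} {h. r h \<le> M}"
proof -
  define I where "I = {j \<in> {1..}. r (hs j) \<le> M}"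
  have bij: "bij_betw hs I {h. r h \<le> M}"
  proof (rule bij_betw_subset[OF hs])
    show "hs ` I = {h. r h \<le> M}"
      using bij_betw_imp_surj_on[OF hs] by (auto simp: I_def image_iff)
  qed (auto simp: I_def)
  then have fin: "finite I"
    using fin bij_betw_finite by blast
  have down: "i \<in> I" if "j \<in> I" "1 \<le> i" "i \<le> j" for i j
  proof -
    have "r (hs i) \<le> r (hs j)"
      using \<open>i \<le> j\<close>
    proof (induction rule: dec_induct)
      case (step k)
      then show ?case
        using mono[of k] \<open>1 \<le> i\<close> by simp
    qed simp
    then show ?thesis
      using that by (simp add: I_def)
  qed
  have "I = {1..card I}"
  proof (cases "I = {}")
    case False
    then have "I = {1..Max I}"
      using fin down[OF Max_in[OF fin False]] by (auto simp: I_def)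
    then show ?thesis
      by (metis card_atLeastAtMost diff_Suc_1)
  qed simp
  then show ?thesis
    using bij bij_betw_same_card[OF bij] by metis
qed

text \<open>Basis functions \<open>2 * j - 1\<close> and \<open>2 * j\<close> share the frequency
  \<open>hs j\<close>; this is the source of the factor 2 in \<open>J\<close>.\<close>

lemma sum_pairs: "(\<Sum>k=1..2 * (N::nat). f ((k + 1) div 2)) = 2 * (\<Sum>j=1..N. f j :: real)"
  by (induction N) (auto simp: algebra_simps)

lemma psi_eq_wave:
  assumes "k \<ge> 1"
  shows "psi \<eta> r hs k = (\<lambda>x. ((if odd k then 1 else \<i>) * of_real (\<eta> / r (hs ((k + 1) div 2)))) *
    wave (hs ((k + 1) div 2)) x)"
  using assms by (auto simp: psi_def Let_def wave_def fun_eq_iff)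

text \<open>Plane waves are eigenfunctions, so a word of derivatives only multiplies by a product of
  frequencies: a power of 2 pi times at most the weight occurring in \<open>J\<close>.\<close>

lemma norm_iter_partial_psi_le:
  assumes "k \<ge> 1" "\<eta> > 0" "\<And>h. r h > 0" "\<And>p. real (count_list ps p) \<le> \<omega>"
  shows "norm (iter_partial ps (psi \<eta> r hs k) x) \<le> (2 * pi) ^ length ps *
    (\<eta> * ((\<Prod>p\<in>supp (hs ((k + 1) div 2)). \<bar>real_of_int (hs ((k + 1) div 2) $ p)\<bar> powr \<omega>) / r (hs ((k + 1) div 2))))"
proof -
  define h where "h = hs ((k + 1) div 2)"
  have freq: "norm (prod_list (map (freq h) ps)) = (2 * pi) ^ length ps * prod_list (map (\<lambda>p. \<bar>real_of_int (h $ p)\<bar>) ps)"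
    by (induction ps) (auto simp: norm_mult norm_freq)
  define c :: complex where "c = (if odd k then 1 else \<i>) * of_real (\<eta> / r h)"
  have "psi \<eta> r hs k = (\<lambda>x. c * wave h x)"
    unfolding c_def h_def by (rule psi_eq_wave[OF assms(1)])
  moreover have "norm c = \<eta> / r h"
    using assms(2) assms(3)[of h] by (simp add: c_def norm_mult norm_divide)
  ultimately have "norm (iter_partial ps (psi \<eta> r hs k) x) = \<eta> / r h * norm (prod_list (map (freq h) ps))"
    by (simp add: iter_partial_cmult smooth_wave iter_partial_wave norm_mult)
  also have "\<dots> \<le> \<eta> / r h * ((2 * pi) ^ length ps * (\<Prod>p\<in>supp h. \<bar>real_of_int (h $ p)\<bar> powr \<omega>))"
    unfolding freq using assms(2) assms(3)[of h]
    by (intro mult_left_mono prod_list_abs_le assms(4)) auto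
  finally show ?thesis
    by (simp add: h_def field_simps)
qed

lemma smooth_periodic_psi: "smooth (psi \<eta> r hs k)" "periodic (psi \<eta> r hs k)"
proof -
  have "smooth (psi \<eta> r hs k) \<and> periodic (psi \<eta> r hs k)"
  proof (cases "k = 0")
    case True
    then have "psi \<eta> r hs k = (\<lambda>x. 1)"
      by (simp add: psi_def fun_eq_iff)
    then show ?thesis
      by (simp add: smooth_const periodic_def)
  next
    case False
    then have "k \<ge> 1" by simp
    have "periodic (\<lambda>x. c * wave h x)" for c h
      using periodic_wave[of h] by (simp add: periodic_def)
    then show ?thesis
      unfolding psi_eq_wave[OF \<open>k \<ge> 1\<close>] by (intro conjI smooth_cmult smooth_wave)
  qed
  then show "smooth (psi \<eta> r hs k)" "periodic (psi \<eta> r hs k)"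
    by auto
qed

text \<open>A common form for the affine and the Chebyshev field. A nonempty word annihilates the
  constant \<open>psi \<eta> r hs 0\<close>, and the coefficients of the other terms have modulus at
  most 1, so the weights add up to \<open>J\<close>.\<close>

lemma field_bounds:
  fixes r :: "int ^ 'd::finite \<Rightarrow> real"
  assumes u: "u = (\<lambda>x. psi \<eta> r hs 0 x + (\<Sum>k=1..2 * card \<A>. of_real (c k) * psi \<eta> r hs k x))"
    and c: "\<And>k. k \<in> {1..2 * card \<A>} \<Longrightarrow> \<bar>c k\<bar> \<le> 1"
    and hs: "bij_betw hs {1..card \<A>} \<A>" and pos: "\<eta> > 0" "\<And>h. r h > 0"
    and J: "J = 2 * \<eta> * (\<Sum>h\<in>\<A>. (\<Prod>p\<in>supp h. \<bar>real_of_int (h $ p)\<bar> powr \<omega>) / r h)"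
  shows "smooth u" "periodic u"
    and "(\<And>p. real (count_list ps p) \<le> \<omega>) \<Longrightarrow> ps \<noteq> [] \<Longrightarrow> norm (iter_partial ps u x) \<le> J * (2 * pi) ^ length ps"
proof -
  have smooth_term: "smooth (\<lambda>x. of_real (c k) * psi \<eta> r hs k x)" for k
    by (intro smooth_cmult smooth_periodic_psi)
  show "smooth u"
    unfolding u by (intro smooth_add smooth_sum smooth_term smooth_periodic_psi)
  show "periodic u"
    using smooth_periodic_psi(2)[of \<eta> r hs] by (simp add: periodic_def u)
  assume ps: "\<And>p. real (count_list ps p) \<le> \<omega>" "ps \<noteq> []"
  define g where "g h = (\<Prod>p\<in>supp h. \<bar>real_of_int (h $ p)\<bar> powr \<omega>) / r h" for h
  have "psi \<eta> r hs 0 = (\<lambda>x. 1)"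
    by (simp add: psi_def fun_eq_iff)
  then have "iter_partial ps u x = (\<Sum>k=1..2 * card \<A>. of_real (c k) * iter_partial ps (psi \<eta> r hs k) x)"
    unfolding u using ps(2)
    by (simp add: iter_partial_add smooth_const smooth_sum smooth_term iter_partial_const iter_partial_sum
        iter_partial_cmult smooth_periodic_psi)
  also have "norm \<dots> \<le> (\<Sum>k=1..2 * card \<A>. 1 * ((2 * pi) ^ length ps * (\<eta> * g (hs ((k + 1) div 2)))))"
  proof (intro sum_norm_le)
    fix k assume k: "k \<in> {1..2 * card \<A>}"
    have "norm (iter_partial ps (psi \<eta> r hs k) x) \<le> (2 * pi) ^ length ps * (\<eta> * g (hs ((k + 1) div 2)))"
      unfolding g_def using k by (intro norm_iter_partial_psi_le pos ps) auto
    then show "norm (of_real (c k) * iter_partial ps (psi \<eta> r hs k) x)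
        \<le> 1 * ((2 * pi) ^ length ps * (\<eta> * g (hs ((k + 1) div 2))))"
      unfolding norm_mult using c[OF k] by (intro mult_mono) auto
  qed
  also have "\<dots> = (2 * pi) ^ length ps * (\<eta> * (2 * (\<Sum>j=1..card \<A>. g (hs j))))"
    using sum_pairs[of "\<lambda>j. g (hs j)" "card \<A>"] by (simp flip: sum_distrib_left)
  also have "(\<Sum>j=1..card \<A>. g (hs j)) = (\<Sum>h\<in>\<A>. g h)"
    by (rule sum.reindex_bij_betw[OF hs])
  also have "(2 * pi) ^ length ps * (\<eta> * (2 * \<dots>)) = J * (2 * pi) ^ length ps"
    by (simp add: J g_def)
  finally show "norm (iter_partial ps u x) \<le> J * (2 * pi) ^ length ps" .
qed

section \<open>The derivative bound for the whole network\<close>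

lemma norm_vec_inf_norm_le:
  assumes "m > 0" "\<And>i. i \<in> {1..m} \<Longrightarrow> norm (v i) \<le> B"
  shows "norm (vec_inf_norm m v) \<le> B"
proof -
  have "vec_inf_norm m v \<in> (\<lambda>i. norm (v i)) ` {1..m}"
    unfolding vec_inf_norm_def using assms(1) by (intro Max_in) auto
  then show ?thesis
    using assms(2) by auto
qed

theorem theorem3:
  fixes r :: "int ^ 'd \<Rightarrow> real" and hs :: "nat \<Rightarrow> int ^ 'd" and M \<eta> a_min \<omega> \<xi> \<tau> J S :: real
    and \<A> :: "(int ^ 'd) set" and s L d\<^sub>u :: nat and dims :: "nat \<Rightarrow> nat"
    and a :: "real ^ 'd \<Rightarrow> (nat \<Rightarrow> real) \<Rightarrow> complex"
    and \<sigma> :: "real \<Rightarrow> real"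
    and P Q :: "nat \<Rightarrow> nat \<Rightarrow> real" and W :: "nat \<Rightarrow> nat \<Rightarrow> nat \<Rightarrow> real"
    and \<kappa> :: "nat \<Rightarrow> int ^ 'd \<Rightarrow> nat \<Rightarrow> nat \<Rightarrow> complex" and b :: "nat \<Rightarrow> nat \<Rightarrow> real"
    and G :: "real ^ 'd \<Rightarrow> (nat \<Rightarrow> real) \<Rightarrow> nat \<Rightarrow> complex"
    and R A \<Lambda> :: "nat \<Rightarrow> real" and C :: ereal
    and axs :: "'d list" and \<nu> :: "nat ^ 'd"
  assumes r_pos: "\<And>h. r h > 0"
    and hs_bij: "bij_betw hs {1..} UNIV"
    and hs_decr: "\<And>j. j \<ge> 1 \<Longrightarrow> 1 / r (hs j) \<ge> 1 / r (hs (Suc j))"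
    and M_pos: "M > 0"
    and index_set: "\<A> = index_set r M" and finite_index_set: "finite \<A>"
    and s: "s = 2 * card \<A>"
    and \<eta>_pos: "\<eta> > 0"
    and field: "a = affine_field \<eta> r hs s \<or> a = chebyshev_field \<eta> r hs s"
    and a_min_pos: "a_min > 0"
    and field_lower: "\<And>x y. x \<in> spatial_domain \<Longrightarrow> y \<in> param_domain s \<Longrightarrow> Re (a x y) \<ge> a_min"
    and depth: "L \<ge> 1"
    and dims_pos: "\<And>l. l \<in> {1..L + 1} \<Longrightarrow> dims l > 0" and du_pos: "d\<^sub>u > 0"
    and \<sigma>_smooth: "\<And>n t. (deriv ^^ n) \<sigma> field_differentiable (at t)"
    and G: "G = fno \<A> L dims \<sigma> P Q W \<kappa> b a"
    and \<omega>: "\<omega> \<ge> 1"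
    and J: "J = 2 * \<eta> * (\<Sum>h\<in>\<A>. (\<Prod>p\<in>supp h. \<bar>real_of_int (h $ p)\<bar> powr \<omega>) / r h)"
    and R_pos: "\<And>l. l \<ge> 1 \<Longrightarrow> R l > 0" and A_pos: "\<And>n. n \<ge> 1 \<Longrightarrow> A n > 0"
    and R: "\<And>l. l \<in> {1..L} \<Longrightarrow>
              mat_inf_norm (dims (l + 1)) (dims l) (W l)
                + (\<Sum>h\<in>\<A>. mat_inf_norm (dims (l + 1)) (dims l) (\<kappa> l h)) \<le> R l"
    and A: "\<And>n. n \<ge> 1 \<Longrightarrow> sup_norm UNIV ((deriv ^^ n) \<sigma>) \<le> ereal (A n)"
    and \<xi>_pos: "\<xi> > 0" and \<tau>_pos: "\<tau> > 0"
    and A_eq: "\<And>n. n \<ge> 1 \<Longrightarrow> A n = \<xi> * \<tau> ^ n * fact n"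
    and \<Lambda>: "\<And>k. \<Lambda> k = (\<Prod>t=1..k. \<xi> * \<tau> * R t)"
    and C: "C = max (sup_norm (spatial_domain \<times> param_domain s) (\<lambda>(x, y). vec_inf_norm d\<^sub>u (G x y)))
                    (ereal (mat_inf_norm d\<^sub>u (dims (L + 1)) Q * (\<xi> * \<Lambda> L / (\<Sum>k=1..L. \<Lambda> k))))"
    and S: "S = 1 + mat_inf_norm (dims 1) 1 P * J / \<xi> * (\<Sum>k=1..L. \<Lambda> k)"
    and axs: "distinct axs" "set axs = UNIV"
    and \<nu>: "real (multi_max \<nu>) \<le> \<omega>"
  shows "(\<forall>y\<in>param_domain s. \<forall>k\<in>{1..d\<^sub>u}. has_mixed_partial axs \<nu> (\<lambda>z. G z y k)) \<and>
         sup_norm (spatial_domain \<times> param_domain s)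
           (\<lambda>(x, y). vec_inf_norm d\<^sub>u (\<lambda>k. mixed_partial axs \<nu> (\<lambda>z. G z y k) x))
         \<le> C * ereal ((2 * pi) ^ multi_abs \<nu> * fact (multi_abs \<nu>) * S ^ multi_abs \<nu>)"
proof -
  \<comment> \<open>Words using each axis at most \<omega> times: closed under subwords, containing
    the word of \<nu>, and within reach of the weights in \<open>J\<close>.\<close>
  define adm where "adm ps \<longleftrightarrow> (\<forall>p. real (count_list ps p) \<le> \<omega>)" for ps :: "'d list"
  define B where "B = mat_inf_norm (dims 1) 1 P * J"
  define N where "N = mat_inf_norm d\<^sub>u (dims (L + 1)) Q"
  define n where "n = multi_abs \<nu>"
  let ?w = "multi_axes axs \<nu>"
  have adm_subseq: "adm qs" if "adm ps" "subseq qs ps" for ps qs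
    using that count_list_subseq[OF that(2)] unfolding adm_def by (meson of_nat_le_iff order_trans)
  have "\<nu> $ p \<le> multi_max \<nu>" for p
    unfolding multi_max_def by (intro Max_ge) auto
  then have adm: "adm ?w"
    using count_list_multi_axes[OF axs(1), of \<nu>] \<nu> unfolding adm_def by (meson of_nat_le_iff order_trans)
  have len: "length ?w = n"
    using length_multi_axes[OF axs] by (simp add: n_def)
  have \<sigma>_bound: "\<bar>(deriv ^^ k) \<sigma> t\<bar> \<le> \<xi> * \<tau> ^ k * fact k" if "k \<ge> 1" for k t
  proof -
    have "ereal (norm ((deriv ^^ k) \<sigma> t)) \<le> sup_norm UNIV ((deriv ^^ k) \<sigma>)"
      unfolding sup_norm_def by (rule SUP_upper) simp
    also have "\<dots> \<le> ereal (A k)"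
      by (rule A[OF that])
    finally show ?thesis
      using A_eq[OF that] by simp
  qed
  have \<Lambda>_pos: "\<Lambda> k > 0" for k
    unfolding \<Lambda> using R_pos \<xi>_pos \<tau>_pos by (intro prod_pos) auto
  have J_nonneg: "0 \<le> J"
    unfolding J using \<eta>_pos r_pos
    by (intro mult_nonneg_nonneg sum_nonneg divide_nonneg_pos prod_nonneg) auto
  have P_nonneg: "0 \<le> mat_inf_norm (dims 1) 1 P"
    using dims_pos by (intro mat_inf_norm_nonneg) auto
  have B_nonneg: "0 \<le> B"
    using P_nonneg J_nonneg by (simp add: B_def)
  have N_nonneg: "0 \<le> N"
    unfolding N_def using du_pos by (rule mat_inf_norm_nonneg)
  have S_eq: "S = 1 + B / \<xi> * (\<Sum>k=1..L. \<Lambda> k)"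
    by (simp add: S B_def)
  have sum_\<Lambda>_pos: "(\<Sum>k=1..L. \<Lambda> k) > 0"
    using depth \<Lambda>_pos by (intro sum_pos) auto
  then have S_ge: "1 \<le> S"
    using B_nonneg \<xi>_pos by (simp add: S_eq)

  have r_mono: "r (hs j) \<le> r (hs (Suc j))" if "j \<ge> 1" for j
    using hs_decr[OF that] r_pos by (simp add: field_simps)
  have hs: "bij_betw hs {1..card \<A>} \<A>"
    using image_enumeration_eq_sublevel[OF hs_bij r_mono, of M] finite_index_set
    unfolding index_set index_set_def by simp
  have field_props: "smooth (\<lambda>z. a z y) \<and> periodic (\<lambda>z. a z y) \<and>
      (\<forall>ps x. adm ps \<longrightarrow> ps \<noteq> [] \<longrightarrow> norm (iter_partial ps (\<lambda>z. a z y) x) \<le> J * (2 * pi) ^ length ps)"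
    if y: "y \<in> param_domain s" for y
  proof -
    \<comment> \<open>The coefficients are \<open>y k - 1 / 2\<close> or
      \<open>sin (2 * pi * y k)\<close>, both in [-1, 1].\<close>
    obtain c where c: "(\<lambda>z. a z y) = (\<lambda>x. psi \<eta> r hs 0 x + (\<Sum>k=1..2 * card \<A>. of_real (c k) * psi \<eta> r hs k x))"
      "\<And>k. k \<in> {1..2 * card \<A>} \<Longrightarrow> \<bar>c k\<bar> \<le> 1"
    proof (cases "a = affine_field \<eta> r hs s")
      case True
      show ?thesis
      proof (rule that)
        show "(\<lambda>z. a z y) = (\<lambda>x. psi \<eta> r hs 0 x + (\<Sum>k=1..2 * card \<A>. of_real (y k - 1 / 2) * psi \<eta> r hs k x))"
          by (simp only: True affine_field_def s)
        show "\<bar>y k - 1 / 2\<bar> \<le> 1" if "k \<in> {1..2 * card \<A>}" for k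
        proof -
          have "y k \<in> {0..1}"
            using y that unfolding param_domain_def s by (rule PiE_mem)
          then show ?thesis by (simp add: abs_le_iff)
        qed
      qed
    next
      case False
      then have a: "a = chebyshev_field \<eta> r hs s"
        using field by simp
      show ?thesis
      proof (rule that)
        show "(\<lambda>z. a z y) = (\<lambda>x. psi \<eta> r hs 0 x + (\<Sum>k=1..2 * card \<A>. of_real (sin (2 * pi * y k)) * psi \<eta> r hs k x))"
          by (simp only: a chebyshev_field_def s)
      qed simp
    qed
    show ?thesis
      using field_bounds[OF c hs \<eta>_pos r_pos J] unfolding adm_def by blast
  qed

  let ?act = "\<lambda>y x i. complex_activation \<sigma> (fno_pre \<A> dims \<sigma> P W \<kappa> b (\<lambda>z. a z y) L x i)"
  have G_eq: "(\<lambda>z. G z y k) = (\<lambda>x. \<Sum>i=1..dims (L + 1). of_real (Q k i) * ?act y x i)" for y k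
    by (simp add: G fno_def)
  have smooth_act: "smooth (\<lambda>x. ?act y x i)" if "y \<in> param_domain s" for y i
  proof -
    have "smooth (\<lambda>x. fno_pre \<A> dims \<sigma> P W \<kappa> b (\<lambda>z. a z y) L x i)"
      using smooth_periodic_fno_pre[OF \<sigma>_smooth] field_props[OF that] by blast
    from smooth_complex_activation[OF \<sigma>_smooth this, of 0] show ?thesis by simp
  qed
  have smooth_G: "smooth (\<lambda>z. G z y k)" if "y \<in> param_domain s" for y k
    unfolding G_eq by (intro smooth_sum smooth_cmult smooth_act that)

  have act_bound: "deriv_bounded adm (2 * pi * B * \<Lambda> L) (2 * pi * S) (\<lambda>x. ?act y x i)"
    if y: "y \<in> param_domain s" and i: "i \<in> {1..dims (L + 1)}" for y i
    unfolding S_eq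
  proof (rule deriv_bounded_fno_pre[OF \<sigma>_smooth \<sigma>_bound adm_subseq _ _ B_nonneg _ \<xi>_pos \<tau>_pos R_pos R \<Lambda> _ i])
    show "deriv_bounded adm (2 * pi * B) (2 * pi) (\<lambda>x. of_real (P i 1) * a x y)" if "i \<in> {1..dims 1}" for i
      unfolding deriv_bounded_def
    proof (intro allI impI)
      fix ps x assume ps: "adm ps" "ps \<noteq> []"
      have "norm (iter_partial ps (\<lambda>x. of_real (P i 1) * a x y) x) = \<bar>P i 1\<bar> * norm (iter_partial ps (\<lambda>z. a z y) x)"
        using field_props[OF y] by (simp add: iter_partial_cmult norm_mult)
      also have "\<dots> \<le> mat_inf_norm (dims 1) 1 P * (J * (2 * pi) ^ length ps)"
        using field_props[OF y] ps row_sum_le_mat_inf_norm[OF that, of P 1] P_nonneg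
        by (intro mult_mono) auto
      also have "\<dots> = 2 * pi * B * (2 * pi) ^ (length ps - 1)"
        using ps(2) by (cases ps) (auto simp: B_def)
      \<comment> \<open>Derivatives of the field grow without a factorial, but the majorant has one,
        so a factor at least 1 is inserted.\<close>
      also have "\<dots> \<le> fact (length ps) * (2 * pi * B * (2 * pi) ^ (length ps - 1))"
        using mult_right_mono[OF fact_ge_1[of "length ps"], of "2 * pi * B * (2 * pi) ^ (length ps - 1)"] B_nonneg
        by simp
      finally show "norm (iter_partial ps (\<lambda>x. of_real (P i 1) * a x y) x)
          \<le> fact (length ps) * (2 * pi * B * (2 * pi) ^ (length ps - 1))" .
    qed
  qed (use field_props[OF y] depth in auto)

  have G_bound: "norm (mixed_partial axs \<nu> (\<lambda>z. G z y k) x)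
      \<le> N * (\<xi> * \<Lambda> L / (\<Sum>k=1..L. \<Lambda> k)) * ((2 * pi) ^ n * fact n * S ^ n)"
    if n: "n \<noteq> 0" and y: "y \<in> param_domain s" and k: "k \<in> {1..d\<^sub>u}" for x y k
  proof -
    let ?D = "fact n * (2 * pi * B * \<Lambda> L * (2 * pi * S) ^ (n - 1))"
    have D_nonneg: "0 \<le> ?D"
      using B_nonneg \<Lambda>_pos[of L] S_ge by simp
    have "?w \<noteq> []"
      using n len by auto
    have "norm (mixed_partial axs \<nu> (\<lambda>z. G z y k) x)
        = norm (\<Sum>i=1..dims (L + 1). of_real (Q k i) * iter_partial ?w (\<lambda>x. ?act y x i) x)"
      unfolding mixed_partial_def G_eq
      using smooth_act[OF y] by (simp add: iter_partial_sum smooth_cmult iter_partial_cmult)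
    also have "\<dots> \<le> (\<Sum>i=1..dims (L + 1). norm (Q k i) * ?D)"
    proof (intro sum_norm_le)
      fix i assume "i \<in> {1..dims (L + 1)}"
      then have "norm (iter_partial ?w (\<lambda>x. ?act y x i) x) \<le> ?D"
        using deriv_boundedD[OF act_bound[OF y] adm \<open>?w \<noteq> []\<close>] len by simp
      then show "norm (of_real (Q k i) * iter_partial ?w (\<lambda>x. ?act y x i) x) \<le> norm (Q k i) * ?D"
        by (simp add: norm_mult mult_left_mono)
    qed
    also have "\<dots> \<le> N * ?D"
      unfolding sum_distrib_right[symmetric] N_def
      by (intro mult_right_mono row_sum_le_mat_inf_norm k D_nonneg)
    also have "\<dots> \<le> N * (\<xi> * \<Lambda> L / (\<Sum>k=1..L. \<Lambda> k)) * ((2 * pi) ^ n * fact n * S ^ n)"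
    proof -
      \<comment> \<open>Eliminating \<open>B\<close> through \<open>S\<close> exposes the prefactor
        \<xi> \<Lambda> L / sum \<Lambda> of the claim; what remains is
        \<open>(S - 1) * S ^ (n - 1)\<close>, at most \<open>S ^ n\<close>.\<close>
      have B_eq: "B = \<xi> / (\<Sum>k=1..L. \<Lambda> k) * (S - 1)"
        using sum_\<Lambda>_pos \<xi>_pos by (simp add: S_eq)
      have "?D = \<xi> * \<Lambda> L / (\<Sum>k=1..L. \<Lambda> k) * ((2 * pi) ^ n * fact n) * ((S - 1) * S ^ (n - 1))"
        unfolding B_eq using n by (cases n) (simp_all add: power_mult_distrib)
      also have "\<dots> \<le> \<xi> * \<Lambda> L / (\<Sum>k=1..L. \<Lambda> k) * ((2 * pi) ^ n * fact n) * (S * S ^ (n - 1))"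
        using S_ge \<xi>_pos \<Lambda>_pos[of L] sum_\<Lambda>_pos by (intro mult_left_mono mult_right_mono) auto
      also have "S * S ^ (n - 1) = S ^ n"
        using n by (cases n) auto
      finally have "N * ?D \<le> N * (\<xi> * \<Lambda> L / (\<Sum>k=1..L. \<Lambda> k) * ((2 * pi) ^ n * fact n) * S ^ n)"
        using N_nonneg by (rule mult_left_mono)
      then show ?thesis
        by (simp only: mult.assoc)
    qed
    finally show ?thesis .
  qed

  have "has_mixed_partial axs \<nu> (\<lambda>z. G z y k)" if "y \<in> param_domain s" for y k
    unfolding has_mixed_partial_def by (rule smooth_iter_partially_differentiable[OF smooth_G[OF that]])
  moreover have "sup_norm (spatial_domain \<times> param_domain s)
      (\<lambda>(x, y). vec_inf_norm d\<^sub>u (\<lambda>k. mixed_partial axs \<nu> (\<lambda>z. G z y k) x))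
      \<le> C * ereal ((2 * pi) ^ n * fact n * S ^ n)"
  \<comment> \<open>Order 0 is covered by the first argument of the maximum in \<open>C\<close>,
    every positive order by the second.\<close>
  proof (cases "n = 0")
    case True
    then have "?w = []"
      using len by simp
    then have "sup_norm (spatial_domain \<times> param_domain s)
        (\<lambda>(x, y). vec_inf_norm d\<^sub>u (\<lambda>k. mixed_partial axs \<nu> (\<lambda>z. G z y k) x)) \<le> C"
      by (simp add: mixed_partial_def C)
    then show ?thesis
      using True by (simp add: one_ereal_def[symmetric])
  next
    case False
    let ?K = "(2 * pi) ^ n * fact n * S ^ n"
    let ?X = "N * (\<xi> * \<Lambda> L / (\<Sum>k=1..L. \<Lambda> k))"
    have "sup_norm (spatial_domain \<times> param_domain s)
        (\<lambda>(x, y). vec_inf_norm d\<^sub>u (\<lambda>k. mixed_partial axs \<nu> (\<lambda>z. G z y k) x)) \<le> ereal ?X * ereal ?K"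
      unfolding sup_norm_def
    proof (rule SUP_least, clarify)
      fix x y assume y: "y \<in> param_domain s"
      have "norm (vec_inf_norm d\<^sub>u (\<lambda>k. mixed_partial axs \<nu> (\<lambda>z. G z y k) x)) \<le> ?X * ?K"
        by (intro norm_vec_inf_norm_le du_pos G_bound[OF False y])
      then show "ereal (norm (vec_inf_norm d\<^sub>u (\<lambda>k. mixed_partial axs \<nu> (\<lambda>z. G z y k) x))) \<le> ereal ?X * ereal ?K"
        by simp
    qed
    also have "\<dots> \<le> C * ereal ?K"
      using S_ge by (intro ereal_mult_right_mono) (auto simp: C N_def)
    finally show ?thesis .
  qed
  ultimately show ?thesis
    unfolding n_def by blast
qed

end
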